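(* Let $\Gamma$ be a free group on $p\ge 2$ generators acting convex co-compactly on a $\mathrm{CAT}(-1)$ space $(X,d)$, let $o\in X$ be an arbitrary base point, let $|\cdot|$ be word length on $\Gamma$ with respect to a fixed free generating set $\mathcal A=\{a_1,\dots,a_p\}$, and let $\lambda>0$ be the limit $$\lambda=\lim_{n\to\infty}\frac{1}{\#\{x\in\Gamma: |x|=n\}}\sum_{x\in\Gamma,\ |x|=n}\frac{d(o,xo)}{n}.$$ Let $\mathfrak C$ be a non-trivial conjugacy class in $\Gamma$, let $k=\min\{|x| : x\in\mathfrak C\}$, and let $\mathfrak C_n=\{x\in\mathfrak C : |x|=n\}$. Then $$\lim_{m\to\infty}\frac{1}{\#\mathfrak C_{k+2m}}\sum_{x\in\mathfrak C_{k+2m}}\frac{d(o,xo)}{k+2m}=\lambda .$$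
   Context: The action of $\Gamma$ on $X$ is by isometries and properly discontinuous. It is convex co-compact if the quotient by $\Gamma$ of the intersection of $X$ with the convex hull of the limit set of $\Gamma$ is compact. In this situation (Švarc–Milnor) there are constants $C_1,C_2>0$ with $C_1|x|\le d(o,xo)\le C_2|x|$ for all $x\in\Gamma$, and it is known that the limit defining $\lambda$ exists and is positive. The set $\mathfrak C_n$ is non-empty if and only if $n=k+2m$ for some integer $m\ge 0$. A conjugacy class is non-trivial if it is not $\{1\}$. *)

theory Defs
  imports "HOL-Analysis.Analysis" "HOL-Algebra.Group_Action"
begin

section \<open>The hyperbolic plane and CAT(-1) spaces\<close>

text \<open>The hyperboloid model: points \<open>(t, z)\<close> on the upper sheet of \<open>t\<^sup>2 - |z|\<^sup>2 = 1\<close> in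
  \<open>\<real> \<times> \<complex> = \<real>\<^sup>3\<close>, with \<open>cosh d\<close> equal to minus the Lorentz form.\<close>

definition hyperbolic_plane :: "(real \<times> complex) set" where
  "hyperbolic_plane = {u. fst u > 0 \<and> (fst u)\<^sup>2 - (norm (snd u))\<^sup>2 = 1}"

definition hyperbolic_dist :: "real \<times> complex \<Rightarrow> real \<times> complex \<Rightarrow> real" where
  "hyperbolic_dist u v = arcosh (fst u * fst v - snd u \<bullet> snd v)"

text \<open>Geodesics are isometric embeddings of intervals; only the values on \<open>I\<close> are relevant.\<close>

definition geodesic_on :: "real set \<Rightarrow> (real \<Rightarrow> 'a::metric_space) \<Rightarrow> bool" where
  "geodesic_on I c \<longleftrightarrow> (\<forall>s\<in>I. \<forall>t\<in>I. dist (c s) (c t) = \<bar>s - t\<bar>)"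

definition geodesic_segment :: "(real \<Rightarrow> 'a::metric_space) \<Rightarrow> 'a \<Rightarrow> 'a \<Rightarrow> bool" where
  "geodesic_segment c x y \<longleftrightarrow>
     geodesic_on {0..dist x y} c \<and> c 0 = x \<and> c (dist x y) = y"

text \<open>\<open>(P, Q, R)\<close> is a comparison triangle for \<open>(p, q, r)\<close>, and \<open>X\<close>, \<open>Y\<close> are the comparison
  points of \<open>c s\<close>, \<open>e t\<close>: two distances determine a point of a hyperbolic segment. Relabelling
  the vertices covers every choice of two sides of the triangle.\<close>

class cat_minus_one = metric_space +
  assumes geodesic_segment_exists: "\<exists>c. geodesic_segment c x y"
    and comparison:
      "\<lbrakk>geodesic_segment c p q; geodesic_segment e p r; s \<in> {0..dist p q}; t \<in> {0..dist p r};
        {P, Q, R, X, Y} \<subseteq> hyperbolic_plane;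
        hyperbolic_dist P Q = dist p q; hyperbolic_dist P R = dist p r;
        hyperbolic_dist Q R = dist q r;
        hyperbolic_dist P X = s; hyperbolic_dist X Q = dist p q - s;
        hyperbolic_dist P Y = t; hyperbolic_dist Y R = dist p r - t\<rbrakk>
       \<Longrightarrow> dist (c s) (e t) \<le> hyperbolic_dist X Y"


section \<open>Boundary at infinity, limit set and convex hull\<close>

definition geodesic_ray :: "(real \<Rightarrow> 'a::metric_space) \<Rightarrow> bool" where
  "geodesic_ray c \<longleftrightarrow> geodesic_on {0..} c"

definition geodesic_line :: "(real \<Rightarrow> 'a::metric_space) \<Rightarrow> bool" where
  "geodesic_line c \<longleftrightarrow> geodesic_on UNIV c"

definition asymptotic :: "((real \<Rightarrow> 'a::metric_space) \<times> (real \<Rightarrow> 'a)) set" where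
  "asymptotic = {(c, e). geodesic_ray c \<and> geodesic_ray e \<and> (\<exists>B. \<forall>t\<ge>0. dist (c t) (e t) \<le> B)}"

definition boundary_at_infinity :: "(real \<Rightarrow> 'a::metric_space) set set" where
  "boundary_at_infinity = Collect geodesic_ray // asymptotic"

text \<open>Convergence to a boundary point in the cone topology on the union of the space and its
  boundary: for every ray \<open>c\<close> representing the boundary point, the geodesics from \<open>c 0\<close> to
  \<open>x n\<close> become arbitrarily long and converge to \<open>c\<close> uniformly on compact sets.\<close>

definition converges_to_boundary ::
    "(nat \<Rightarrow> 'a::metric_space) \<Rightarrow> (real \<Rightarrow> 'a) set \<Rightarrow> bool" where
  "converges_to_boundary x \<xi> \<longleftrightarrow>
     (\<forall>c\<in>\<xi>. \<forall>T\<ge>0. \<forall>\<epsilon>>0. \<forall>\<^sub>F n in sequentially.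
        T \<le> dist (c 0) (x n) \<and>
        (\<forall>\<sigma>. geodesic_segment \<sigma> (c 0) (x n) \<longrightarrow> (\<forall>t\<in>{0..T}. dist (\<sigma> t) (c t) < \<epsilon>)))"

definition limit_set ::
    "('g, 'b) monoid_scheme \<Rightarrow> ('g \<Rightarrow> 'x \<Rightarrow> 'x) \<Rightarrow> 'x::metric_space \<Rightarrow> (real \<Rightarrow> 'x) set set" where
  "limit_set G \<phi> x0 =
     {\<xi> \<in> boundary_at_infinity.
        \<exists>g. (\<forall>n. g n \<in> carrier G) \<and> converges_to_boundary (\<lambda>n. \<phi> (g n) x0) \<xi>}"

text \<open>Convexity of \<open>C \<union> B\<close> in the union of the space and its boundary, where \<open>C\<close> consists of
  points of the space and \<open>B\<close> of boundary points: geodesic segments, rays and lines joining two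
  of its points stay inside.\<close>

definition convex_with_boundary ::
    "'a::metric_space set \<Rightarrow> (real \<Rightarrow> 'a) set set \<Rightarrow> bool" where
  "convex_with_boundary C B \<longleftrightarrow>
     (\<forall>x\<in>C. \<forall>y\<in>C. \<forall>c. geodesic_segment c x y \<longrightarrow> c ` {0..dist x y} \<subseteq> C) \<and>
     (\<forall>x\<in>C. \<forall>\<xi>\<in>B. \<forall>c\<in>\<xi>. geodesic_ray c \<and> c 0 = x \<longrightarrow> c ` {0..} \<subseteq> C) \<and>
     (\<forall>\<xi>\<in>B. \<forall>\<eta>\<in>B. \<forall>c. geodesic_line c \<and> c \<in> \<xi> \<and> (\<lambda>t. c (- t)) \<in> \<eta> \<longrightarrow> range c \<subseteq> C)"

text \<open>The part inside the space of the (closed) convex hull of a set of boundary points.\<close>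

definition hull_of_boundary_set :: "(real \<Rightarrow> 'a::metric_space) set set \<Rightarrow> 'a set" where
  "hull_of_boundary_set B = \<Inter>{C. closed C \<and> convex_with_boundary C B}"


section \<open>Convex co-compact actions\<close>

definition isometric_action ::
    "('g, 'b) monoid_scheme \<Rightarrow> ('g \<Rightarrow> 'x::metric_space \<Rightarrow> 'x) \<Rightarrow> bool" where
  "isometric_action G \<phi> \<longleftrightarrow>
     group_action G UNIV \<phi> \<and> (\<forall>g\<in>carrier G. \<forall>x y. dist (\<phi> g x) (\<phi> g y) = dist x y)"

definition properly_discontinuous ::
    "('g, 'b) monoid_scheme \<Rightarrow> ('g \<Rightarrow> 'x::metric_space \<Rightarrow> 'x) \<Rightarrow> bool" where
  "properly_discontinuous G \<phi> \<longleftrightarrow>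
     (\<forall>K. compact K \<longrightarrow> finite {g \<in> carrier G. \<phi> g ` K \<inter> K \<noteq> {}})"

definition quotient_topology :: "'a topology \<Rightarrow> ('a \<Rightarrow> 'b) \<Rightarrow> 'b topology" where
  "quotient_topology T f =
     topology (\<lambda>U. U \<subseteq> f ` topspace T \<and> openin T {x \<in> topspace T. f x \<in> U})"

lemma openin_quotient_topology:
  "openin (quotient_topology T f) U \<longleftrightarrow>
     U \<subseteq> f ` topspace T \<and> openin T {x \<in> topspace T. f x \<in> U}"
proof -
  have "istopology (\<lambda>U. U \<subseteq> f ` topspace T \<and> openin T {x \<in> topspace T. f x \<in> U})"
    unfolding istopology_def
  proof (intro conjI allI impI; (elim conjE)?)
    fix S S' assume "openin T {x \<in> topspace T. f x \<in> S}" "openin T {x \<in> topspace T. f x \<in> S'}"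
    then have "openin T ({x \<in> topspace T. f x \<in> S} \<inter> {x \<in> topspace T. f x \<in> S'})"
      by (rule openin_Int)
    moreover have "{x \<in> topspace T. f x \<in> S} \<inter> {x \<in> topspace T. f x \<in> S'} =
        {x \<in> topspace T. f x \<in> S \<inter> S'}" by blast
    ultimately show "openin T {x \<in> topspace T. f x \<in> S \<inter> S'}" by simp
  next
    fix \<K> assume *: "\<forall>K\<in>\<K>. K \<subseteq> f ` topspace T \<and> openin T {x \<in> topspace T. f x \<in> K}"
    then have "openin T (\<Union>K\<in>\<K>. {x \<in> topspace T. f x \<in> K})"
      by blast
    moreover have "(\<Union>K\<in>\<K>. {x \<in> topspace T. f x \<in> K}) = {x \<in> topspace T. f x \<in> \<Union>\<K>}"
      by blast
    ultimately show "openin T {x \<in> topspace T. f x \<in> \<Union>\<K>}" by simp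
  qed blast+
  then show ?thesis
    by (simp add: quotient_topology_def)
qed

lemma quotient_map_quotient_topology: "quotient_map T (quotient_topology T f) f"
proof -
  have "{x \<in> topspace T. f x \<in> f ` topspace T} = topspace T" by blast
  then have "openin (quotient_topology T f) (f ` topspace T)"
    by (simp add: openin_quotient_topology)
  then have "topspace (quotient_topology T f) = f ` topspace T"
    by (meson openin_quotient_topology openin_subset openin_topspace subset_antisym)
  then show ?thesis
    by (simp add: quotient_map_def openin_quotient_topology)
qed

text \<open>Non-emptiness excludes degenerate cases such as groups fixing their only limit point, for
  which the hull contains no point of the space and its quotient would be vacuously compact.
  The limit set does not depend on the base point \<open>x0\<close>.\<close>

definition convex_cocompact ::
    "('g, 'b) monoid_scheme \<Rightarrow> ('g \<Rightarrow> 'x \<Rightarrow> 'x) \<Rightarrow> 'x::metric_space \<Rightarrow> bool" where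
  "convex_cocompact G \<phi> x0 \<longleftrightarrow>
     (let Y = hull_of_boundary_set (limit_set G \<phi> x0)
      in Y \<noteq> {} \<and> compact_space (quotient_topology (top_of_set Y) (orbit G \<phi>)))"


section \<open>Free groups, word length and conjugacy classes\<close>

text \<open>Words are lists of letters \<open>(a, b)\<close>; the letter stands for \<open>a\<close> if \<open>b\<close> holds and for the
  inverse of \<open>a\<close> otherwise.\<close>

definition words :: "'g set \<Rightarrow> ('g \<times> bool) list set" where
  "words A = lists (A \<times> UNIV)"

fun word_value :: "('g, 'b) monoid_scheme \<Rightarrow> ('g \<times> bool) list \<Rightarrow> 'g" where
  "word_value G [] = \<one>\<^bsub>G\<^esub>"
| "word_value G ((a, b) # w) = (if b then a else inv\<^bsub>G\<^esub> a) \<otimes>\<^bsub>G\<^esub> word_value G w"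

definition reduced :: "('g \<times> bool) list \<Rightarrow> bool" where
  "reduced w \<longleftrightarrow> successively (\<lambda>(a, b) (a', b'). \<not> (a = a' \<and> b \<noteq> b')) w"

definition free_generating_set :: "('g, 'b) monoid_scheme \<Rightarrow> 'g set \<Rightarrow> bool" where
  "free_generating_set G A \<longleftrightarrow>
     A \<subseteq> carrier G \<and> bij_betw (word_value G) {w \<in> words A. reduced w} (carrier G)"

definition word_length :: "('g, 'b) monoid_scheme \<Rightarrow> 'g set \<Rightarrow> 'g \<Rightarrow> nat" where
  "word_length G A x = (LEAST n. \<exists>w\<in>words A. word_value G w = x \<and> length w = n)"

definition sphere_in :: "('g, 'b) monoid_scheme \<Rightarrow> 'g set \<Rightarrow> 'g set \<Rightarrow> nat \<Rightarrow> 'g set" where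
  "sphere_in G A S n = {x \<in> S. word_length G A x = n}"

definition conjugacy_classes :: "('g, 'b) monoid_scheme \<Rightarrow> 'g set set" where
  "conjugacy_classes G =
     {{g \<otimes>\<^bsub>G\<^esub> x \<otimes>\<^bsub>G\<^esub> inv\<^bsub>G\<^esub> g | g. g \<in> carrier G} | x. x \<in> carrier G}"

end

theory Submission
  imports Defs
begin

text \<open>
  The displacement \<open>d(o, xo)\<close> of a long element of a conjugacy class is governed by the
  conjugating word. A non-trivial class consists of the reduced words \<open>v\<inverse> u v\<close>, where the
  core \<open>u\<close> is one of finitely many cyclically reduced words of length \<open>k\<close>, and where \<open>v\<close> is any
  reduced word whose first letter differs from two letters determined by \<open>u\<close>
  (\<open>sphere_in_conjugacy_class\<close>). The element has length \<open>k + 2 |v|\<close>. If one can show that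
  \<open>d(o, v\<inverse>uvo) = 2 d(o, vo) + o(|v|)\<close>, then the mean over the class is a finite mean of twice the
  means of \<open>d(o, vo)\<close> over words \<open>v\<close> with a given first letter.

  The estimate is geometric. Triangles in a CAT(-1) space are uniformly thin (\<open>thin_triangle\<close>),
  which follows from an explicit comparison triangle in the hyperboloid. By repeated halving, a
  geodesic with the same ends as a path of \<open>n\<close> bounded steps is within \<open>O(log n)\<close> of that path.
  If the path also separates points linearly, a connectedness argument gives the converse:
  the path is within \<open>O(log n)\<close> of the geodesic (\<open>quasi_geodesic_near_geodesic\<close>). The prefixes of
  a reduced word give such a path in the orbit of \<open>o\<close>. Linear separation is the lower bound of
  Svarc and Milnor (\<open>Svarc_Milnor_lower_bound\<close>), and it is the point at which the action must be
  properly discontinuous and convex co-compact. Consequently displacements of the parts of a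
  reduced word add up with a logarithmic error (\<open>displ_reduced_append\<close>), which is harmless after
  division by the length.

  It remains to pass from the mean over the whole sphere to the mean over the words with first
  letter \<open>s\<close> (\<open>mean_displ_from_tendsto\<close>). Deleting \<open>s\<close> leaves an arbitrary reduced word not
  starting with \<open>s\<inverse>\<close>; hence, up to a bounded error, \<open>2p - 1\<close> times the mean for \<open>s\<close> is the sum
  of the previous means for all letters, which is known, minus the previous mean for \<open>s\<inverse>\<close>.
  After division by the length, the deviation of these means from \<open>\<lambda>\<close> thus decreases by a factor
  \<open>2p - 1\<close> from one sphere to the next, up to a null sequence, and tends to zero.
\<close>


section \<open>Thin triangles\<close>

text \<open>In polar coordinates around \<open>(1, 0)\<close> the distance formula of the hyperboloid model is the
  hyperbolic law of cosines, so a comparison triangle with prescribed side lengths is written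
  down by choosing the angle at one vertex.\<close>
lemma hyperbolic_dist_polar:
  "hyperbolic_dist (cosh b, of_real (sinh b) * cis \<alpha>) (cosh c, of_real (sinh c) * cis \<beta>) =
     arcosh (cosh b * cosh c - sinh b * sinh c * cos (\<alpha> - \<beta>))"
  by (simp add: hyperbolic_dist_def inner_complex_def cos_diff algebra_simps)

lemma hyperbolic_plane_polar: "(cosh b, of_real (sinh b) * cis \<alpha>) \<in> hyperbolic_plane"
  by (simp add: hyperbolic_plane_def norm_mult cosh_square_eq)

lemma hyperbolic_dist_same_direction:
  assumes "s \<le> b"
  shows "hyperbolic_dist (cosh s, of_real (sinh s) * cis \<alpha>) (cosh b, of_real (sinh b) * cis \<alpha>) = b - s"
proof -
  have "cosh s * cosh b - sinh s * sinh b = cosh (b - s)"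
    by (simp add: cosh_diff algebra_simps)
  then show ?thesis
    using assms by (simp add: hyperbolic_dist_polar arcosh_cosh_real)
qed

lemma sinh_mult_sinh: "sinh x * sinh y = (cosh (x + y) - cosh (x - y)) / (2::real)"
  by (simp add: cosh_add cosh_diff)

text \<open>The left side is \<open>cosh b - cosh (2 * g - b)\<close>, which is at most \<open>cosh b - 1\<close>. Used twice, this
  bounds the distance in \<open>fellow_travel\<close> independently of the size of the triangle.\<close>
lemma two_sinh_mult_sinh_le:
  fixes g b :: real
  assumes "0 \<le> g" "g \<le> b"
  shows "2 * (sinh g * sinh (b - g)) \<le> sinh b"
proof -
  have "2 * (sinh g * sinh (b - g)) = cosh b - cosh (2 * g - b)"
    by (simp add: sinh_mult_sinh)
  also have "\<dots> \<le> cosh b - 1"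
    by (simp add: cosh_real_ge_1)
  also have "\<dots> \<le> sinh b"
    using cosh_minus_sinh[of b] assms by (smt (verit) exp_le_one_iff)
  finally show ?thesis .
qed

lemma arcosh_le_2:
  assumes "1 \<le> x" "x \<le> (3/2::real)"
  shows "arcosh x \<le> 2"
proof (rule ccontr)
  assume "\<not> arcosh x \<le> 2"
  then have "cosh 2 < cosh (arcosh x)"
    by (subst cosh_real_nonneg_less_iff) auto
  then have "cosh 2 < x"
    using assms by simp
  moreover have "3 / 2 \<le> cosh (2::real)"
    using exp_ge_add_one_self[of "2::real"] exp_gt_zero[of "-2::real"]
    by (simp add: cosh_def del: exp_gt_zero)
  ultimately show False
    using assms by linarith
qed

text \<open>Two sides of a triangle stay close up to the Gromov product at their common vertex. Write
  \<open>a\<close>, \<open>b\<close>, \<open>d\<close> for the lengths of the opposite side and of the two sides, \<open>g\<close> for the Gromov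
  product and \<open>\<kappa>\<close> for the cosine of the comparison angle. The law of cosines gives
  \<open>1 - \<kappa> = 2 sinh (b - g) sinh (d - g) / (sinh b sinh d)\<close>, while the comparison points at
  distance \<open>t \<le> g\<close> have distance with \<open>cosh\<close> equal to \<open>1 + (sinh t)\<^sup>2 (1 - \<kappa>)\<close>; this is at most
  \<open>3/2\<close>.\<close>
lemma fellow_travel:
  fixes p q r :: "'a::cat_minus_one"
  assumes c: "geodesic_segment c p q" and e: "geodesic_segment e p r"
    and t: "0 \<le> t" "t \<le> (dist p q + dist p r - dist q r) / 2"
  shows "dist (c t) (e t) \<le> 2"
proof (cases "dist p q = 0 \<or> dist p r = 0")
  case True
  then have "t = 0"
    using t by (auto simp: dist_commute)
  then show ?thesis
    using c e by (simp add: geodesic_segment_def)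
next
  case False
  define b where "b = dist p q"
  define d where "d = dist p r"
  define a where "a = dist q r"
  define g where "g = (b + d - a) / 2"
  have pos: "b > 0" "d > 0" "a \<ge> 0"
    using False by (auto simp: b_def d_def a_def)
  have tri: "a \<le> b + d" "b \<le> a + d" "d \<le> a + b"
    using dist_triangle[of q r p] dist_triangle[of p q r] dist_triangle[of p r q]
    by (simp_all add: a_def b_def d_def dist_commute)
  have g: "0 \<le> g" "g \<le> b" "g \<le> d" "t \<le> g" "t \<le> b" "t \<le> d"
    using tri t by (auto simp: g_def a_def b_def d_def)
  define \<kappa> where "\<kappa> = (cosh b * cosh d - cosh a) / (sinh b * sinh d)"
  have sp: "sinh b * sinh d > 0"
    using pos by simp
  have "cosh \<bar>b - d\<bar> \<le> cosh a" "cosh a \<le> cosh (b + d)"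
    using tri pos by (subst cosh_real_nonneg_le_iff; simp)+
  then have \<kappa>: "-1 \<le> \<kappa>" "\<kappa> \<le> 1"
    using sp by (simp_all add: \<kappa>_def field_simps cosh_add cosh_diff)
  \<comment> \<open>The comparison angle exists because the triangle inequalities say exactly that \<open>\<kappa>\<close> is a cosine.\<close>
  define \<theta> where "\<theta> = arccos \<kappa>"
  have cos: "cos \<theta> = \<kappa>"
    using \<kappa> by (simp add: \<theta>_def)
  define pt where "pt = (\<lambda>(s::real) (\<alpha>::real). (cosh s, complex_of_real (sinh s) * cis \<alpha>))"
  have pt0: "pt 0 \<alpha> = pt 0 \<beta>" for \<alpha> \<beta>
    by (simp add: pt_def)
  have rad: "hyperbolic_dist (pt s \<alpha>) (pt s' \<alpha>) = s' - s" if "s \<le> s'" for s s' \<alpha>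
    using hyperbolic_dist_same_direction[OF that] by (simp add: pt_def)
  have rad': "hyperbolic_dist (pt 0 0) (pt s \<theta>) = s" if "0 \<le> s" for s
    using rad[OF that, of \<theta>] pt0[of 0 \<theta>] by simp
  have law: "cosh b * cosh d - sinh b * sinh d * \<kappa> = cosh a"
    using pos by (simp add: \<kappa>_def)
  have QR: "hyperbolic_dist (pt b 0) (pt d \<theta>) = a"
    using hyperbolic_dist_polar[of b 0 d \<theta>] law pos
    by (simp add: pt_def cos arcosh_cosh_real)
  have "dist (c t) (e t) \<le> hyperbolic_dist (pt t 0) (pt t \<theta>)"
  proof (rule comparison[OF c e, where P = "pt 0 0" and Q = "pt b 0" and R = "pt d \<theta>"])
    show "{pt 0 0, pt b 0, pt d \<theta>, pt t 0, pt t \<theta>} \<subseteq> hyperbolic_plane"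
      using hyperbolic_plane_polar unfolding pt_def by blast
  qed (use t g pos rad rad' QR in \<open>auto simp: b_def[symmetric] d_def[symmetric] a_def[symmetric]\<close>)
  also have "\<dots> = arcosh (1 + sinh t * sinh t * (1 - \<kappa>))"
    using hyperbolic_dist_polar[of t 0 t \<theta>] cosh_square_eq[of t]
    by (simp add: pt_def cos algebra_simps power2_eq_square)
  also have "\<dots> \<le> 2"
  proof (rule arcosh_le_2)
    show "1 \<le> 1 + sinh t * sinh t * (1 - \<kappa>)"
      using \<kappa> by simp
    have eq: "1 - \<kappa> = 2 * sinh (b - g) * sinh (d - g) / (sinh b * sinh d)"
    proof -
      have "2 * (sinh (b - g) * sinh (d - g)) = cosh a - cosh (b - d)"
      proof -
        have "b - g + (d - g) = a" "b - g - (d - g) = b - d"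
          by (simp_all add: g_def)
        then show ?thesis by (simp add: sinh_mult_sinh)
      qed
      also have "\<dots> = cosh a - (cosh b * cosh d - sinh b * sinh d)"
        by (simp add: cosh_diff)
      also have "\<dots> = (1 - \<kappa>) * (sinh b * sinh d)"
        using law by (simp add: algebra_simps)
      finally show ?thesis
        using pos by (simp add: eq_divide_eq)
    qed
    have "sinh t * sinh t * (1 - \<kappa>) \<le> sinh g * sinh g * (1 - \<kappa>)"
      using g t \<kappa> by (intro mult_right_mono mult_mono) auto
    also have "\<dots> = (2 * (sinh g * sinh (b - g))) * (2 * (sinh g * sinh (d - g))) / (2 * (sinh b * sinh d))"
      unfolding eq by simp
    also have "\<dots> \<le> (sinh b * sinh d) / (2 * (sinh b * sinh d))"
      using g pos by (intro divide_right_mono mult_mono two_sinh_mult_sinh_le) auto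
    also have "\<dots> = 1/2"
      using pos by simp
    finally show "1 + sinh t * sinh t * (1 - \<kappa>) \<le> 3/2" by simp
  qed
  finally show ?thesis .
qed

lemma geodesic_segment_reverse:
  assumes "geodesic_segment c p q"
  shows "geodesic_segment (\<lambda>t. c (dist p q - t)) q p"
  using assms unfolding geodesic_segment_def geodesic_on_def
  by (auto simp: dist_commute)

text \<open>The inscribed circle touches the side from \<open>p\<close> to \<open>q\<close> at a point which splits it into two
  parts: the part at \<open>p\<close> fellow-travels the side from \<open>p\<close> to \<open>r\<close>, and the part at \<open>q\<close> the
  side from \<open>q\<close> to \<open>r\<close>.\<close>
lemma thin_triangle:
  fixes p q r :: "'a::cat_minus_one"
  assumes c: "geodesic_segment c p q" and e: "geodesic_segment e p r" and f: "geodesic_segment f r q"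
    and t: "t \<in> {0..dist p q}"
  shows "(\<exists>s\<in>{0..dist p r}. dist (c t) (e s) \<le> 2) \<or> (\<exists>s\<in>{0..dist r q}. dist (c t) (f s) \<le> 2)"
proof (cases "t \<le> (dist p q + dist p r - dist q r) / 2")
  case True
  moreover have "dist p q \<le> dist p r + dist q r"
    using dist_triangle[of p q r] by (simp add: dist_commute)
  ultimately show ?thesis
    using fellow_travel[OF c e] t by (intro disjI1 bexI[of _ t]) auto
next
  case False
  have tri: "dist p q \<le> dist p r + dist r q"
    "dist p r \<le> dist p q + dist q r"
    using dist_triangle[of p q r] dist_triangle[of p r q] by (simp_all add: dist_commute)
  have "dist (c (dist p q - (dist p q - t))) (f (dist r q - (dist p q - t))) \<le> 2"
    using False t tri
    by (intro fellow_travel[OF geodesic_segment_reverse[OF c] geodesic_segment_reverse[OF f]])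
      (auto simp: dist_commute field_simps)
  moreover have "dist r q - (dist p q - t) \<in> {0..dist r q}"
    using False t tri by (auto simp: dist_commute field_simps)
  ultimately show ?thesis
    by auto
qed


section \<open>Logarithmic stability of quasi-geodesics\<close>

text \<open>Halving the path and replacing a geodesic by the two other sides of a triangle costs one
  application of thinness, so the geodesic is within a distance of the path that grows with the
  logarithm of the number of steps.\<close>
lemma geodesic_near_path:
  fixes y :: "nat \<Rightarrow> 'a::cat_minus_one"
  assumes step: "\<And>i. a \<le> i \<Longrightarrow> i < b \<Longrightarrow> dist (y i) (y (Suc i)) \<le> L" and "0 \<le> L"
    and "a \<le> b" and "b - a \<le> 2 ^ N"
    and c: "geodesic_segment c (y a) (y b)" and t: "t \<in> {0..dist (y a) (y b)}"
  shows "\<exists>i\<in>{a..b}. dist (c t) (y i) \<le> L + 2 * real N"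
  using assms
proof (induction N arbitrary: a b c t)
  case 0
  have "dist (c t) (y a) = t"
    using 0 unfolding geodesic_segment_def geodesic_on_def by force
  moreover have "dist (y a) (y b) \<le> L"
  proof (cases "a = b")
    case False
    then have "b = Suc a" using 0 by simp
    then show ?thesis using 0 by simp
  qed (use 0 in simp)
  ultimately show ?case
    using 0 by (intro bexI[of _ a]) auto
next
  case (Suc N)
  define m where "m = a + (b - a) div 2"
  have m: "a \<le> m" "m \<le> b" "m - a \<le> 2 ^ N" "b - m \<le> 2 ^ N"
    using Suc.prems by (auto simp: m_def)
  obtain e where e: "geodesic_segment e (y a) (y m)"
    using geodesic_segment_exists by blast
  obtain f where f: "geodesic_segment f (y m) (y b)"
    using geodesic_segment_exists by blast
  consider s where "s \<in> {0..dist (y a) (y m)}" "dist (c t) (e s) \<le> 2"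
    | s where "s \<in> {0..dist (y m) (y b)}" "dist (c t) (f s) \<le> 2"
    using thin_triangle[OF Suc.prems(5) e f Suc.prems(6)] by blast
  then show ?case
  proof cases
    case 1
    obtain i where i: "i \<in> {a..m}" "dist (e s) (y i) \<le> L + 2 * real N"
      using Suc.IH[OF _ Suc.prems(2) m(1,3) e 1(1)] Suc.prems(1) m by force
    have "dist (c t) (y i) \<le> L + 2 * real (Suc N)"
      using dist_triangle[of "c t" "y i" "e s"] i 1 by simp
    then show ?thesis using i m by (intro bexI[of _ i]) auto
  next
    case 2
    obtain i where i: "i \<in> {m..b}" "dist (f s) (y i) \<le> L + 2 * real N"
      using Suc.IH[OF _ Suc.prems(2) m(2,4) f 2(1)] Suc.prems(1) m by force
    have "dist (c t) (y i) \<le> L + 2 * real (Suc N)"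
      using dist_triangle[of "c t" "y i" "f s"] i 2 by simp
    then show ?thesis using i m by (intro bexI[of _ i]) auto
  qed
qed

lemma dist_path_le:
  fixes y :: "nat \<Rightarrow> 'a::metric_space"
  assumes "\<And>i. i < n \<Longrightarrow> dist (y i) (y (Suc i)) \<le> L" "i \<le> j" "j \<le> n"
  shows "dist (y i) (y j) \<le> L * real (j - i)"
  using assms(2,3)
proof (induction j rule: dec_induct)
  case base
  show ?case by simp
next
  case (step k)
  then have "dist (y i) (y (Suc k)) \<le> L * real (k - i) + L"
    using dist_triangle[of "y i" "y (Suc k)" "y k"] assms(1)[of k] by force
  then show ?case using step by (simp add: Suc_diff_le algebra_simps)
qed

text \<open>The points of the geodesic near the first part of the path and those near the second part form
  two closed sets that cover an interval and contain one end each, hence they intersect.\<close>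
lemma geodesic_meets_both_sides:
  fixes y :: "nat \<Rightarrow> 'a::metric_space"
  assumes c: "geodesic_segment c (y 0) (y n)" and j: "j \<le> n" and r: "0 \<le> r"
    and near: "\<And>t. t \<in> {0..dist (y 0) (y n)} \<Longrightarrow> \<exists>i\<in>{0..n}. dist (c t) (y i) \<le> r"
  obtains t i l where "t \<in> {0..dist (y 0) (y n)}" "i \<le> j" "j \<le> l" "l \<le> n"
    "dist (c t) (y i) \<le> r" "dist (c t) (y l) \<le> r"
proof -
  define I where "I = {0..dist (y 0) (y n)}"
  define U where "U = (\<lambda>J. \<Union>i\<in>J. I \<inter> c -` cball (y i) r)"
  have "continuous_on I c"
    unfolding continuous_on_iff I_def
    using c unfolding geodesic_segment_def geodesic_on_def by (metis dist_real_def)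
  moreover have "closed I" by (simp add: I_def)
  ultimately have "closed (I \<inter> c -` cball (y i) r)" for i
    by (intro continuous_closed_preimage) auto
  then have cl: "closed (U J)" if "finite J" for J
    unfolding U_def using that by (intro closed_UN) auto
  have "I \<subseteq> U {0..j} \<union> U {j..n}"
  proof
    fix t assume "t \<in> I"
    then obtain i where "i \<in> {0..n}" "dist (c t) (y i) \<le> r"
      using near[of t] unfolding I_def by blast
    then show "t \<in> U {0..j} \<union> U {j..n}"
      using \<open>t \<in> I\<close> by (cases "i \<le> j") (auto simp: U_def dist_commute)
  qed
  moreover have "0 \<in> U {0..j} \<inter> I" "dist (y 0) (y n) \<in> U {j..n} \<inter> I"
    using c j r unfolding U_def I_def geodesic_segment_def
    by (auto intro: bexI[of _ 0] bexI[of _ n])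
  ultimately have "U {0..j} \<inter> U {j..n} \<inter> I \<noteq> {}"
    using connected_closedD[of I "U {0..j}" "U {j..n}"] cl
    by (metis I_def connected_Icc emptyE finite_atLeastAtMost)
  then obtain t i l where "i \<le> j" "j \<le> l" "l \<le> n" "t \<in> I"
      "dist (c t) (y i) \<le> r" "dist (c t) (y l) \<le> r"
    unfolding U_def by (auto simp: dist_commute)
  then show ?thesis
    using that unfolding I_def by blast
qed

text \<open>A logarithmic form of the Morse lemma. Some point of the geodesic is near \<open>y i\<close> and near
  \<open>y l\<close> with \<open>i \<le> j \<le> l\<close>. Then \<open>y i\<close> and \<open>y l\<close> are near each other, the lower bound makes
  \<open>l - i\<close> small, and so \<open>y j\<close> is near the geodesic as well. The sharp statement has an error
  independent of \<open>n\<close>; an error of order \<open>log n\<close> is much cheaper and disappears after division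
  by \<open>n\<close>.\<close>
lemma quasi_geodesic_near_geodesic:
  fixes y :: "nat \<Rightarrow> 'a::cat_minus_one"
  assumes step: "\<And>i. i < n \<Longrightarrow> dist (y i) (y (Suc i)) \<le> L" and L: "0 \<le> L"
    and lower: "\<And>i l. i \<le> l \<Longrightarrow> l \<le> n \<Longrightarrow> real (l - i) \<le> \<alpha> * dist (y i) (y l) + \<beta>"
    and \<alpha>: "0 \<le> \<alpha>" and "n \<le> 2 ^ N" and j: "j \<le> n"
  defines "r \<equiv> L + 2 * real N"
  shows "dist (y 0) (y j) + dist (y j) (y n) \<le> dist (y 0) (y n) + 2 * (r + L * (2 * \<alpha> * r + \<beta>))"
proof -
  obtain c where c: "geodesic_segment c (y 0) (y n)"
    using geodesic_segment_exists by blast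
  have "\<exists>i\<in>{0..n}. dist (c t) (y i) \<le> r" if "t \<in> {0..dist (y 0) (y n)}" for t
    using geodesic_near_path[of 0 n y L N c t] that assms c by auto
  then obtain t i l where t: "t \<in> {0..dist (y 0) (y n)}" and il: "i \<le> j" "j \<le> l" "l \<le> n"
    and near: "dist (c t) (y i) \<le> r" "dist (c t) (y l) \<le> r"
    using geodesic_meets_both_sides[OF c j] L unfolding r_def
    by (metis add_nonneg_nonneg mult_nonneg_nonneg of_nat_0_le_iff zero_le_numeral)
  have "dist (y i) (y l) \<le> 2 * r"
    using near dist_triangle2[of "y i" "y l" "c t"] by (simp add: dist_commute)
  then have "\<alpha> * dist (y i) (y l) \<le> \<alpha> * (2 * r)"
    using \<alpha> by (rule mult_left_mono)
  moreover have "real (l - i) \<le> \<alpha> * dist (y i) (y l) + \<beta>"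
    using il lower by simp
  ultimately have "real (j - i) \<le> 2 * \<alpha> * r + \<beta>"
    using il by simp
  then have "L * real (j - i) \<le> L * (2 * \<alpha> * r + \<beta>)"
    using L by (rule mult_left_mono)
  moreover have "dist (y i) (y j) \<le> L * real (j - i)"
    using dist_path_le[of n y L i j] step il(1) j by blast
  ultimately have cj: "dist (c t) (y j) \<le> r + L * (2 * \<alpha> * r + \<beta>)"
    using near dist_triangle[of "c t" "y j" "y i"] by simp
  have "dist (y 0) (c t) = t" "dist (c t) (y n) = dist (y 0) (y n) - t"
    using c t unfolding geodesic_segment_def geodesic_on_def
    by (smt (verit, best) atLeastAtMost_iff)+
  then show ?thesis
    using dist_triangle[of "y 0" "y j" "c t"] dist_triangle[of "y j" "y n" "c t"] cj
    by (simp add: dist_commute)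
qed


section \<open>Reduced words in a free group\<close>

definition flip :: "'g \<times> bool \<Rightarrow> 'g \<times> bool" where
  "flip l = (fst l, \<not> snd l)"

definition inverse_word :: "('g \<times> bool) list \<Rightarrow> ('g \<times> bool) list" where
  "inverse_word w = rev (map flip w)"

definition reduced_words :: "'g set \<Rightarrow> nat \<Rightarrow> ('g \<times> bool) list set" where
  "reduced_words A n = {w \<in> words A. reduced w \<and> length w = n}"

text \<open>The parameter \<open>n\<close> counts the letters after the first one, so the set has
  \<open>(2 * card A - 1) ^ n\<close> elements.\<close>
definition reduced_words_from :: "'g set \<Rightarrow> 'g \<times> bool \<Rightarrow> nat \<Rightarrow> ('g \<times> bool) list set" where
  "reduced_words_from A s n = {w \<in> reduced_words A (Suc n). hd w = s}"

lemma flip_flip [simp]: "flip (flip l) = l"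
  by (simp add: flip_def)

lemma flip_neq [simp]: "flip l \<noteq> l" "l \<noteq> flip l"
  by (auto simp: flip_def prod_eq_iff)

lemma flip_eq_flip_iff [simp]: "flip l = flip m \<longleftrightarrow> l = m"
  by (auto simp: flip_def prod_eq_iff)

lemma flip_in_letters [simp]: "flip l \<in> A \<times> UNIV \<longleftrightarrow> l \<in> A \<times> UNIV"
  by (cases l) (auto simp: flip_def)

lemma reduced_altdef: "reduced w \<longleftrightarrow> successively (\<lambda>x y. y \<noteq> flip x) w"
proof -
  have "(\<lambda>(a, b) (a', b'). \<not> (a = a' \<and> b \<noteq> b')) = (\<lambda>x y. y \<noteq> flip x)"
    by (auto simp: fun_eq_iff flip_def)
  then show ?thesis unfolding reduced_def by (rule arg_cong)
qed

lemma reduced_Nil [simp]: "reduced []"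
  by (simp add: reduced_altdef)

lemma reduced_Cons: "reduced (x # w) \<longleftrightarrow> w = [] \<or> hd w \<noteq> flip x \<and> reduced w"
  by (simp add: reduced_altdef successively_Cons)

lemma reduced_append:
  "reduced (v @ w) \<longleftrightarrow> reduced v \<and> reduced w \<and> (v = [] \<or> w = [] \<or> hd w \<noteq> flip (last v))"
  by (simp add: reduced_altdef successively_append_iff)

lemma reduced_inverse_word [simp]: "reduced (inverse_word w) \<longleftrightarrow> reduced w"
proof -
  have "successively (\<lambda>x y. x \<noteq> flip y) w \<longleftrightarrow> successively (\<lambda>x y. y \<noteq> flip x) w"
    by (rule successively_cong) auto
  then show ?thesis
    by (simp add: reduced_altdef inverse_word_def successively_map)
qed

lemma inverse_word_simps [simp]:
  "inverse_word [] = []" "inverse_word (l # w) = inverse_word w @ [flip l]"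
  "inverse_word (v @ w) = inverse_word w @ inverse_word v"
  "length (inverse_word w) = length w" "inverse_word w = [] \<longleftrightarrow> w = []"
  "inverse_word (inverse_word w) = w"
  by (auto simp: inverse_word_def rev_map o_def)

lemma last_inverse_word: "w \<noteq> [] \<Longrightarrow> last (inverse_word w) = flip (hd w)"
  by (cases w) auto

lemma words_simps [simp]:
  "[] \<in> words A" "l # w \<in> words A \<longleftrightarrow> l \<in> A \<times> UNIV \<and> w \<in> words A"
  "v @ w \<in> words A \<longleftrightarrow> v \<in> words A \<and> w \<in> words A"
  "inverse_word w \<in> words A \<longleftrightarrow> w \<in> words A"
proof -
  show "inverse_word w \<in> words A \<longleftrightarrow> w \<in> words A"
    by (induction w) (auto simp: words_def flip_def inverse_word_def)
qed (auto simp: words_def)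

lemma words_take_drop: "w \<in> words A \<Longrightarrow> take n w \<in> words A" "w \<in> words A \<Longrightarrow> drop n w \<in> words A"
  by (auto simp: words_def dest: in_set_takeD in_set_dropD)

lemma reduced_take_drop: "reduced w \<Longrightarrow> reduced (take n w)" "reduced w \<Longrightarrow> reduced (drop n w)"
  using reduced_append[of "take n w" "drop n w"] by auto

lemma finite_reduced_words: "finite A \<Longrightarrow> finite (reduced_words A n)"
  by (rule finite_subset[OF _ finite_lists_length_eq[of "A \<times> (UNIV :: bool set)" n]])
    (auto simp: reduced_words_def words_def)

lemma finite_reduced_words_from: "finite A \<Longrightarrow> finite (reduced_words_from A s n)"
  by (simp add: reduced_words_from_def finite_reduced_words)

lemma reduced_words_Suc:
  "reduced_words A (Suc n) = (\<Union>s\<in>A \<times> UNIV. reduced_words_from A s n)"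
proof -
  have "hd w \<in> A \<times> UNIV" if "w \<in> reduced_words A (Suc n)" for w
    using that by (cases w) (auto simp: reduced_words_def)
  then show ?thesis by (auto simp: reduced_words_from_def)
qed

lemma reduced_words_from_0: "s \<in> A \<times> UNIV \<Longrightarrow> reduced_words_from A s 0 = {[s]}"
  by (auto simp: reduced_words_from_def reduced_words_def length_Suc_conv reduced_Cons)

lemma reduced_words_from_Suc:
  assumes "s \<in> A \<times> UNIV"
  shows "reduced_words_from A s (Suc n) =
    (#) s ` (\<Union>t\<in>A \<times> UNIV - {flip s}. reduced_words_from A t n)"
proof (rule Set.set_eqI)
  fix w
  show "w \<in> reduced_words_from A s (Suc n) \<longleftrightarrow>
      w \<in> (#) s ` (\<Union>t\<in>A \<times> UNIV - {flip s}. reduced_words_from A t n)"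
  proof (cases w)
    case (Cons l v)
    show ?thesis
      using assms unfolding Cons
      by (cases v) (auto simp: reduced_words_from_def reduced_words_def reduced_Cons image_iff)
  qed (auto simp: reduced_words_from_def reduced_words_def)
qed

lemma sum_reduced_words_from_Suc:
  assumes "finite A" "s \<in> A \<times> UNIV"
  shows "(\<Sum>w\<in>reduced_words_from A s (Suc n). f w) =
    (\<Sum>t\<in>A \<times> UNIV - {flip s}. \<Sum>w\<in>reduced_words_from A t n. f (s # w))"
proof -
  have "(\<Sum>w\<in>reduced_words_from A s (Suc n). f w) =
      (\<Sum>w\<in>(\<Union>t\<in>A \<times> UNIV - {flip s}. reduced_words_from A t n). f (s # w))"
    unfolding reduced_words_from_Suc[OF assms(2)] by (subst sum.reindex) auto
  also have "\<dots> = (\<Sum>t\<in>A \<times> UNIV - {flip s}. \<Sum>w\<in>reduced_words_from A t n. f (s # w))"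
    using assms(1)
    by (intro sum.UNION_disjoint) (auto simp: finite_reduced_words_from, auto simp: reduced_words_from_def)
  finally show ?thesis .
qed

lemma sum_reduced_words_Suc:
  assumes "finite A"
  shows "(\<Sum>w\<in>reduced_words A (Suc n). f w) =
    (\<Sum>s\<in>A \<times> UNIV. \<Sum>w\<in>reduced_words_from A s n. f w)"
  unfolding reduced_words_Suc using assms
  by (intro sum.UNION_disjoint) (auto simp: finite_reduced_words_from, auto simp: reduced_words_from_def)

lemma card_reduced_words_from:
  assumes "finite A" "s \<in> A \<times> UNIV"
  shows "card (reduced_words_from A s n) = (2 * card A - 1) ^ n"
  using assms(2)
proof (induction n arbitrary: s)
  case 0
  then show ?case by (simp add: reduced_words_from_0)
next
  case (Suc n)
  have "card (reduced_words_from A s (Suc n)) =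
      (\<Sum>t\<in>A \<times> UNIV - {flip s}. card (reduced_words_from A t n))"
    using sum_reduced_words_from_Suc[OF assms(1) Suc.prems, of "\<lambda>_. 1::nat" n] by simp
  also have "\<dots> = card (A \<times> (UNIV::bool set) - {flip s}) * (2 * card A - 1) ^ n"
    using Suc.IH by simp
  also have "card (A \<times> (UNIV::bool set) - {flip s}) = 2 * card A - 1"
    using Suc.prems assms(1) by (subst card_Diff_singleton) (auto simp: card_cartesian_product)
  finally show ?case by simp
qed

locale free_group = group G for G (structure) +
  fixes A
  assumes free: "free_generating_set G A" and finite_generators: "finite A"
begin

abbreviation val where "val \<equiv> word_value G"
abbreviation len where "len \<equiv> word_length G A"

lemma generator_closed [simp]: "a \<in> A \<Longrightarrow> a \<in> carrier G"
  using free by (auto simp: free_generating_set_def)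

lemma word_value_closed [simp]: "w \<in> words A \<Longrightarrow> val w \<in> carrier G"
  by (induction w) (auto split: prod.splits)

lemma word_value_append: "v \<in> words A \<Longrightarrow> w \<in> words A \<Longrightarrow> val (v @ w) = val v \<otimes> val w"
  by (induction v) (auto simp: m_assoc)

lemma word_value_flip: "l \<in> A \<times> UNIV \<Longrightarrow> val [flip l] = inv (val [l])"
  by (cases l) (auto simp: flip_def)

lemma word_value_inverse_word: "w \<in> words A \<Longrightarrow> val (inverse_word w) = inv (val w)"
proof (induction w)
  case (Cons l w)
  then have "val (inverse_word (l # w)) = inv (val w) \<otimes> inv (val [l])"
    by (simp add: word_value_append word_value_flip del: word_value.simps)
  also have "\<dots> = inv (val (l # w))"
    using Cons.prems word_value_append[of "[l]" w] by (simp add: inv_mult_group del: word_value.simps)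
  finally show ?case .
qed simp

lemma reduced_words_inj: "inj_on val {w \<in> words A. reduced w}"
  and reduced_words_surj: "val ` {w \<in> words A. reduced w} = carrier G"
  using free by (auto simp: free_generating_set_def bij_betw_def)

text \<open>Cancelling against the first letter of an already reduced tail is the only reduction needed
  when letters are added one at a time on the left.\<close>
lemma reduction_exists:
  assumes "w \<in> words A"
  shows "\<exists>v\<in>words A. reduced v \<and> val v = val w \<and> length v \<le> length w"
  using assms
proof (induction w)
  case (Cons l w)
  then obtain v where v: "v \<in> words A" "reduced v" "val v = val w" "length v \<le> length w"
    by auto
  have val_Cons: "val (m # u) = val [m] \<otimes> val u" if "m \<in> A \<times> UNIV" "u \<in> words A" for m u
    using that word_value_append[of "[m]" u] by simp
  show ?case
  proof (cases "v \<noteq> [] \<and> hd v = flip l")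
    case True
    then obtain u where u: "v = flip l # u" by (cases v) auto
    have "u \<in> words A" "l \<in> A \<times> UNIV" using u v Cons.prems by auto
    then have u_l: "val [l] \<in> carrier G" "val u \<in> carrier G" "flip l \<in> A \<times> UNIV"
      by (auto simp del: word_value.simps)
    have "val (l # w) = val [l] \<otimes> val v"
      using val_Cons[of l w] Cons.prems v by simp
    also have "val v = inv (val [l]) \<otimes> val u"
      unfolding u using val_Cons[of "flip l" u] word_value_flip[of l] \<open>u \<in> words A\<close> \<open>l \<in> A \<times> UNIV\<close> u_l(3)
      by simp
    also have "val [l] \<otimes> (inv (val [l]) \<otimes> val u) = val u"
      using u_l(1,2) by (simp add: m_assoc[symmetric] del: word_value.simps)
    finally have "val (l # w) = val u" .
    moreover have "reduced u" "length u \<le> length (l # w)"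
      using v(2,4) unfolding u by (auto simp: reduced_Cons)
    ultimately show ?thesis
      using \<open>u \<in> words A\<close> by metis
  next
    case False
    then have "reduced (l # v)"
      using v(2) by (auto simp: reduced_Cons)
    moreover have "l # v \<in> words A" "val (l # v) = val (l # w)"
      using v(1,3) Cons.prems val_Cons[of l v] val_Cons[of l w] by simp_all
    moreover have "length (l # v) \<le> length (l # w)"
      using v(4) by simp
    ultimately show ?thesis by metis
  qed
qed auto

lemma word_length_le: "w \<in> words A \<Longrightarrow> len (val w) \<le> length w"
  unfolding word_length_def by (rule Least_le) auto

text \<open>Any other word for the same element reduces to \<open>w\<close>, by uniqueness of reduced words, and
  reduction does not lengthen a word.\<close>
lemma word_length_reduced:
  assumes "w \<in> words A" "reduced w"
  shows "len (val w) = length w"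
  unfolding word_length_def
proof (rule Least_equality)
  fix n assume "\<exists>v\<in>words A. val v = val w \<and> length v = n"
  then obtain v u where "v \<in> words A" "val v = val w" "length v = n"
    "u \<in> words A" "reduced u" "val u = val v" "length u \<le> length v"
    using reduction_exists by blast
  moreover from this have "u = w"
    using assms reduced_words_inj by (auto dest: inj_onD)
  ultimately show "length w \<le> n" by simp
qed (use assms in auto)

lemma reduced_word_exists:
  assumes "x \<in> carrier G"
  obtains w where "w \<in> words A" "reduced w" "val w = x" "length w = len x"
proof -
  obtain w where "w \<in> words A" "reduced w" "val w = x"
    using assms unfolding reduced_words_surj[symmetric] by blast
  with word_length_reduced[of w] that[of w] show ?thesis by auto
qed

lemma word_length_mult_le:
  assumes "x \<in> carrier G" "y \<in> carrier G"
  shows "len (x \<otimes> y) \<le> len x + len y"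
proof -
  obtain v where v: "v \<in> words A" "val v = x" "length v = len x"
    using reduced_word_exists[OF assms(1)] by blast
  obtain w where w: "w \<in> words A" "val w = y" "length w = len y"
    using reduced_word_exists[OF assms(2)] by blast
  show ?thesis
    using v w word_length_le[of "v @ w"] by (simp add: word_value_append)
qed

lemma inj_on_reduced_words: "inj_on val (reduced_words A n)"
  by (rule inj_on_subset[OF reduced_words_inj]) (auto simp: reduced_words_def)

lemma sphere_in_carrier: "sphere_in G A (carrier G) n = val ` reduced_words A n"
proof (intro equalityI subsetI)
  fix x assume "x \<in> sphere_in G A (carrier G) n"
  then show "x \<in> val ` reduced_words A n"
    using reduced_word_exists[of x] by (force simp: sphere_in_def reduced_words_def)
qed (auto simp: sphere_in_def reduced_words_def word_length_reduced)

end


section \<open>Orbits grow linearly\<close>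

locale isometric_group_action = group G for G (structure) +
  fixes \<phi> :: "'a \<Rightarrow> 'x::metric_space \<Rightarrow> 'x"
  assumes isometric: "isometric_action G \<phi>"
begin

sublocale group_action G UNIV \<phi>
  using isometric by (simp add: isometric_action_def)

lemma act_mult: "g \<in> carrier G \<Longrightarrow> h \<in> carrier G \<Longrightarrow> \<phi> (g \<otimes> h) x = \<phi> g (\<phi> h x)"
  by (simp add: composition_rule)

lemma act_one [simp]: "\<phi> \<one> x = x"
  using id_eq_one by (metis UNIV_I restrict_apply')

lemma act_inv [simp]:
  assumes "g \<in> carrier G"
  shows "\<phi> (inv g) (\<phi> g x) = x" "\<phi> g (\<phi> (inv g) x) = x"
  using assms act_mult[of g "inv g" x] act_mult[of "inv g" g x] by simp_all

lemma dist_act [simp]: "g \<in> carrier G \<Longrightarrow> dist (\<phi> g x) (\<phi> g y) = dist x y"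
  using isometric by (simp add: isometric_action_def)

lemma dist_act_inv:
  assumes "g \<in> carrier G"
  shows "dist (\<phi> (inv g) x) y = dist x (\<phi> g y)"
  using dist_act[of g "\<phi> (inv g) x" y] assms by simp

lemma geodesic_on_act [simp]: "g \<in> carrier G \<Longrightarrow> geodesic_on I (\<phi> g \<circ> c) \<longleftrightarrow> geodesic_on I c"
  by (simp add: geodesic_on_def)

lemma geodesic_segment_act:
  "g \<in> carrier G \<Longrightarrow> geodesic_segment c x y \<Longrightarrow> geodesic_segment (\<phi> g \<circ> c) (\<phi> g x) (\<phi> g y)"
  by (simp add: geodesic_segment_def)

lemma geodesic_ray_act [simp]: "g \<in> carrier G \<Longrightarrow> geodesic_ray (\<phi> g \<circ> c) \<longleftrightarrow> geodesic_ray c"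
  and geodesic_line_act [simp]: "g \<in> carrier G \<Longrightarrow> geodesic_line (\<phi> g \<circ> c) \<longleftrightarrow> geodesic_line c"
  by (simp_all add: geodesic_ray_def geodesic_line_def)

lemma act_comp_inv [simp]:
  assumes "g \<in> carrier G"
  shows "\<phi> (inv g) \<circ> (\<phi> g \<circ> c) = c" "\<phi> g \<circ> (\<phi> (inv g) \<circ> c) = c"
  using assms by (auto simp: fun_eq_iff)

text \<open>The translate of a boundary point, written as a preimage so that no representing ray has to be
  chosen.\<close>
definition boundary_act :: "'a \<Rightarrow> (real \<Rightarrow> 'x) set \<Rightarrow> (real \<Rightarrow> 'x) set" where
  "boundary_act g \<xi> = {e. \<phi> (inv g) \<circ> e \<in> \<xi>}"

lemma boundary_act_in_boundary:
  assumes g: "g \<in> carrier G" and "\<xi> \<in> boundary_at_infinity"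
  shows "boundary_act g \<xi> \<in> boundary_at_infinity"
proof -
  obtain c where c: "geodesic_ray c" "\<xi> = asymptotic `` {c}"
    using assms(2) by (auto simp: boundary_at_infinity_def quotient_def)
  have "e \<in> boundary_act g \<xi> \<longleftrightarrow> e \<in> asymptotic `` {\<phi> g \<circ> c}" for e
  proof -
    have "dist (c t) (\<phi> (inv g) (e t)) = dist (\<phi> g (c t)) (e t)" for t
      using dist_act_inv[OF g, of "e t" "c t"] by (simp add: dist_commute)
    then show ?thesis
      using c g by (simp add: boundary_act_def asymptotic_def)
  qed
  then have "boundary_act g \<xi> = asymptotic `` {\<phi> g \<circ> c}"
    by blast
  then show ?thesis
    using c g by (auto simp: boundary_at_infinity_def intro: quotientI)
qed

lemma converges_to_boundary_act:
  assumes g: "g \<in> carrier G" and conv: "converges_to_boundary x \<xi>"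
  shows "converges_to_boundary (\<lambda>n. \<phi> g (x n)) (boundary_act g \<xi>)"
  unfolding converges_to_boundary_def
proof (intro ballI allI impI)
  fix c and T \<epsilon> :: real
  assume "c \<in> boundary_act g \<xi>" "0 \<le> T" "0 < \<epsilon>"
  then have "\<phi> (inv g) \<circ> c \<in> \<xi>"
    by (simp add: boundary_act_def)
  then have "\<forall>\<^sub>F n in sequentially. T \<le> dist ((\<phi> (inv g) \<circ> c) 0) (x n) \<and>
      (\<forall>\<sigma>. geodesic_segment \<sigma> ((\<phi> (inv g) \<circ> c) 0) (x n) \<longrightarrow>
        (\<forall>t\<in>{0..T}. dist (\<sigma> t) ((\<phi> (inv g) \<circ> c) t) < \<epsilon>))"
    using conv \<open>0 \<le> T\<close> \<open>0 < \<epsilon>\<close> unfolding converges_to_boundary_def by blast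
  then show "\<forall>\<^sub>F n in sequentially. T \<le> dist (c 0) (\<phi> g (x n)) \<and>
      (\<forall>\<sigma>. geodesic_segment \<sigma> (c 0) (\<phi> g (x n)) \<longrightarrow> (\<forall>t\<in>{0..T}. dist (\<sigma> t) (c t) < \<epsilon>))"
  proof (eventually_elim, intro conjI allI impI ballI)
    fix n \<sigma> and t :: real
    assume *: "T \<le> dist ((\<phi> (inv g) \<circ> c) 0) (x n) \<and>
      (\<forall>\<sigma>. geodesic_segment \<sigma> ((\<phi> (inv g) \<circ> c) 0) (x n) \<longrightarrow>
        (\<forall>t\<in>{0..T}. dist (\<sigma> t) ((\<phi> (inv g) \<circ> c) t) < \<epsilon>))"
      and \<sigma>: "geodesic_segment \<sigma> (c 0) (\<phi> g (x n))" and t: "t \<in> {0..T}"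
    have "geodesic_segment (\<phi> (inv g) \<circ> \<sigma>) ((\<phi> (inv g) \<circ> c) 0) (x n)"
      using geodesic_segment_act[of "inv g", OF _ \<sigma>] g by simp
    then have "dist ((\<phi> (inv g) \<circ> \<sigma>) t) ((\<phi> (inv g) \<circ> c) t) < \<epsilon>"
      using * t by blast
    then show "dist (\<sigma> t) (c t) < \<epsilon>"
      using g by simp
  qed (use g dist_act_inv in simp)
qed

lemma boundary_act_limit_set:
  assumes g: "g \<in> carrier G" and "\<xi> \<in> limit_set G \<phi> x0"
  shows "boundary_act g \<xi> \<in> limit_set G \<phi> x0"
proof -
  obtain h where h: "\<And>n. h n \<in> carrier G" "converges_to_boundary (\<lambda>n. \<phi> (h n) x0) \<xi>"
    and \<xi>: "\<xi> \<in> boundary_at_infinity"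
    using assms(2) by (auto simp: limit_set_def)
  have "converges_to_boundary (\<lambda>n. \<phi> (g \<otimes> h n) x0) (boundary_act g \<xi>)"
    using converges_to_boundary_act[OF g h(2)] h(1) g by (simp add: act_mult)
  then show ?thesis
    using boundary_act_in_boundary[OF g \<xi>] h(1) g
    unfolding limit_set_def by (auto intro!: exI[of _ "\<lambda>n. g \<otimes> h n"])
qed

text \<open>The preimage under \<open>\<phi> g\<close> of a closed convex set containing the limit set is another such set,
  because \<open>\<phi> g\<close> maps the limit set into itself. Invariance is what puts the endpoints of the
  geodesics from \<open>y\<close> to \<open>\<phi> g y\<close>, and hence the whole geodesics, inside the hull.\<close>
lemma hull_invariant:
  assumes g: "g \<in> carrier G" and x: "x \<in> hull_of_boundary_set (limit_set G \<phi> x0)"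
  shows "\<phi> g x \<in> hull_of_boundary_set (limit_set G \<phi> x0)"
proof -
  have "\<phi> g x \<in> C" if C: "closed C" "convex_with_boundary C (limit_set G \<phi> x0)" for C
  proof -
    let ?B = "limit_set G \<phi> x0"
    have segment: "c ` {0..dist y z} \<subseteq> C" if "y \<in> C" "z \<in> C" "geodesic_segment c y z" for c y z
      using C(2) that by (simp add: convex_with_boundary_def)
    have ray: "c ` {0..} \<subseteq> C" if "y \<in> C" "\<xi> \<in> ?B" "c \<in> \<xi>" "geodesic_ray c \<and> c 0 = y" for c y \<xi>
      using C(2) that unfolding convex_with_boundary_def by metis
    have line: "range c \<subseteq> C"
      if "\<xi> \<in> ?B" "\<eta> \<in> ?B" "geodesic_line c \<and> c \<in> \<xi> \<and> (\<lambda>t. c (- t)) \<in> \<eta>" for c \<xi> \<eta>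
      using C(2) that unfolding convex_with_boundary_def by metis
    have "continuous_on UNIV (\<phi> g)"
    proof (unfold continuous_on_iff, intro ballI allI impI)
      fix z and e :: real assume "0 < e"
      then show "\<exists>d>0. \<forall>z'\<in>UNIV. dist z' z < d \<longrightarrow> dist (\<phi> g z') (\<phi> g z) < e"
        using g by (intro exI[of _ e]) simp
    qed
    then have "closed (\<phi> g -` C)"
      by (rule closed_vimage[OF C(1)])
    moreover have "convex_with_boundary (\<phi> g -` C) ?B"
      unfolding convex_with_boundary_def
    proof (intro conjI ballI allI impI)
      fix y z c assume "y \<in> \<phi> g -` C" "z \<in> \<phi> g -` C" "geodesic_segment c y z"
      then have "(\<phi> g \<circ> c) ` {0..dist (\<phi> g y) (\<phi> g z)} \<subseteq> C"
        by (intro segment geodesic_segment_act[OF g]) auto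
      then show "c ` {0..dist y z} \<subseteq> \<phi> g -` C"
        using g by (simp add: image_subset_iff)
    next
      fix y \<xi> c assume *: "y \<in> \<phi> g -` C" "\<xi> \<in> ?B" "c \<in> \<xi>" "geodesic_ray c \<and> c 0 = y"
      then have "(\<phi> g \<circ> c) ` {0..} \<subseteq> C"
        using g by (intro ray[of "\<phi> g y" "boundary_act g \<xi>"] boundary_act_limit_set[OF g])
          (simp_all add: boundary_act_def)
      then show "c ` {0..} \<subseteq> \<phi> g -` C"
        by (simp add: image_subset_iff)
    next
      fix \<xi> \<eta> c assume *: "\<xi> \<in> ?B" "\<eta> \<in> ?B" "geodesic_line c \<and> c \<in> \<xi> \<and> (\<lambda>t. c (- t)) \<in> \<eta>"
      have "\<phi> (inv g) \<circ> (\<lambda>t. (\<phi> g \<circ> c) (- t)) = (\<lambda>t. c (- t))"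
        using g by (simp add: fun_eq_iff)
      then have "range (\<phi> g \<circ> c) \<subseteq> C"
        using g * by (intro line[of "boundary_act g \<xi>" "boundary_act g \<eta>"] boundary_act_limit_set[OF g])
          (simp_all add: boundary_act_def)
      then show "range c \<subseteq> \<phi> g -` C"
        by (simp add: image_subset_iff)
    qed
    ultimately have "x \<in> \<phi> g -` C"
      using x unfolding hull_of_boundary_set_def by blast
    then show ?thesis by simp
  qed
  then show ?thesis
    unfolding hull_of_boundary_set_def by blast
qed

text \<open>Proper discontinuity is a statement about compact sets, and balls need not be compact. It is
  applied to a convergent sequence of orbit points together with its limit: an orbit cannot
  accumulate at one of its points.\<close>
lemma orbit_locally_finite:
  assumes pd: "properly_discontinuous G \<phi>"
  shows "\<exists>\<epsilon>>0. finite {g \<in> carrier G. dist (\<phi> g y) y < \<epsilon>}"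
proof -
  let ?O = "(\<lambda>g. \<phi> g y) ` carrier G"
  have "\<not> y islimpt ?O"
  proof
    assume "y islimpt ?O"
    then obtain f where f: "\<And>n. f n \<in> ?O - {y}" "f \<longlonglongrightarrow> y"
      unfolding islimpt_sequential by blast
    let ?K = "insert y (range f)"
    have "compact ?K"
      using compactin_sequence_with_limit[of euclidean f y] f(2) by simp
    then have fin: "finite {g \<in> carrier G. \<phi> g ` ?K \<inter> ?K \<noteq> {}}"
      by (rule pd[unfolded properly_discontinuous_def, rule_format])
    have "range f \<subseteq> (\<lambda>g. \<phi> g y) ` {g \<in> carrier G. \<phi> g ` ?K \<inter> ?K \<noteq> {}}"
    proof
      fix z assume z: "z \<in> range f"
      then obtain g where g: "g \<in> carrier G" "z = \<phi> g y"
        using f(1) by blast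
      then have "z \<in> \<phi> g ` ?K \<inter> ?K"
        using z by blast
      then show "z \<in> (\<lambda>g. \<phi> g y) ` {g \<in> carrier G. \<phi> g ` ?K \<inter> ?K \<noteq> {}}"
        using g by blast
    qed
    then have "finite (range f)"
      using fin finite_surj by blast
    moreover have "y islimpt range f"
      using f unfolding islimpt_sequential by blast
    ultimately show False
      using islimpt_finite by blast
  qed
  then obtain T where T: "open T" "y \<in> T" "\<And>z. z \<in> ?O \<Longrightarrow> z \<in> T \<Longrightarrow> z = y"
    unfolding islimpt_def by blast
  obtain \<epsilon> where \<epsilon>: "\<epsilon> > 0" "ball y \<epsilon> \<subseteq> T"
    using T(1,2) openE by blast
  have "{g \<in> carrier G. dist (\<phi> g y) y < \<epsilon>} \<subseteq> {g \<in> carrier G. \<phi> g ` {y} \<inter> {y} \<noteq> {}}"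
  proof safe
    fix g assume "g \<in> carrier G" "dist (\<phi> g y) y < \<epsilon>" "\<phi> g ` {y} \<inter> {y} = {}"
    then have "\<phi> g y \<in> ball y \<epsilon>" "\<phi> g y \<in> ?O" "\<phi> g y \<noteq> y"
      by (auto simp: dist_commute)
    then show False using T(3) \<epsilon>(2) by blast
  qed
  moreover have "finite {g \<in> carrier G. \<phi> g ` {y} \<inter> {y} \<noteq> {}}"
    by (rule pd[unfolded properly_discontinuous_def, rule_format]) simp
  ultimately show ?thesis
    using \<epsilon>(1) finite_subset by blast
qed

text \<open>Two elements that move \<open>z\<close> near \<open>y\<close> differ by one that moves \<open>z\<close> little, and their inverses
  differ by one that moves \<open>y\<close> little. Local finiteness at the point with the larger radius
  applies.\<close>
lemma transitions_finite:
  assumes y: "finite {g \<in> carrier G. dist (\<phi> g y) y < 2 * \<delta>}"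
    and z: "finite {g \<in> carrier G. dist (\<phi> g z) z < 2 * \<epsilon>}"
  shows "finite {g \<in> carrier G. dist (\<phi> g z) y < (\<delta> + \<epsilon>) / 2}" (is "finite ?T")
proof (cases "?T = {}")
  case False
  then obtain h where h: "h \<in> carrier G" "dist (\<phi> h z) y < (\<delta> + \<epsilon>) / 2"
    by blast
  show ?thesis
  proof (cases "\<delta> \<le> \<epsilon>")
    case True
    have "?T \<subseteq> (\<lambda>g. h \<otimes> g) ` {g \<in> carrier G. dist (\<phi> g z) z < 2 * \<epsilon>}"
    proof
      fix g assume g: "g \<in> ?T"
      then have "dist (\<phi> g z) (\<phi> h z) < \<delta> + \<epsilon>"
        using h dist_triangle2[of "\<phi> g z" "\<phi> h z" y] by auto
      then have "dist (\<phi> (inv h \<otimes> g) z) z < 2 * \<epsilon>"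
        using g h True by (simp add: act_mult dist_act_inv)
      moreover have "g = h \<otimes> (inv h \<otimes> g)"
        using g h by (simp add: m_assoc[symmetric])
      ultimately show "g \<in> (\<lambda>g. h \<otimes> g) ` {g \<in> carrier G. dist (\<phi> g z) z < 2 * \<epsilon>}"
        using g h by blast
    qed
    then show ?thesis using z finite_surj by blast
  next
    case False
    have "?T \<subseteq> (\<lambda>g. inv g \<otimes> h) ` {g \<in> carrier G. dist (\<phi> g y) y < 2 * \<delta>}"
    proof
      fix g assume g: "g \<in> ?T"
      have "dist (\<phi> (inv h) y) z < (\<delta> + \<epsilon>) / 2" "dist (\<phi> (inv g) y) z < (\<delta> + \<epsilon>) / 2"
        using g h dist_act_inv[of h y z] dist_act_inv[of g y z] by (simp_all add: dist_commute)
      then have "dist (\<phi> (inv h) y) (\<phi> (inv g) y) < \<delta> + \<epsilon>"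
        using dist_triangle2[of "\<phi> (inv h) y" "\<phi> (inv g) y" z] by (simp add: field_simps)
      moreover have "dist (\<phi> (h \<otimes> inv g) y) y = dist (\<phi> (inv h) y) (\<phi> (inv g) y)"
        using g h dist_act_inv[of h y "\<phi> (inv g) y"] by (simp add: act_mult dist_commute)
      ultimately have "dist (\<phi> (h \<otimes> inv g) y) y < 2 * \<delta>"
        using False by linarith
      moreover have "g = inv (h \<otimes> inv g) \<otimes> h"
        using g h by (simp add: inv_mult_group m_assoc)
      ultimately show "g \<in> (\<lambda>g. inv g \<otimes> h) ` {g \<in> carrier G. dist (\<phi> g y) y < 2 * \<delta>}"
        using g h by blast
    qed
    then show ?thesis using y finite_surj by blast
  qed
qed (simp only: finite.emptyI)

text \<open>A union of translates of a ball is saturated, so its image in the quotient is open.\<close>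
lemma quotient_compact_finite_cover:
  assumes comp: "compact_space (quotient_topology (top_of_set Y) (orbit G \<phi>))"
    and pos: "\<And>y. y \<in> Y \<Longrightarrow> 0 < r y"
  obtains I where "finite I" "I \<subseteq> Y"
    "\<And>z. z \<in> Y \<Longrightarrow> \<exists>y\<in>I. \<exists>g\<in>carrier G. dist z (\<phi> g y) < r y"
proof -
  let ?Q = "quotient_topology (top_of_set Y) (orbit G \<phi>)"
  define V where "V = (\<lambda>y. {z \<in> Y. \<exists>g\<in>carrier G. dist z (\<phi> g y) < r y})"
  have sat: "z \<in> V y" if zw: "z \<in> Y" "w \<in> V y" "orbit G \<phi> z = orbit G \<phi> w" for z w y
  proof -
    have "z \<in> orbit G \<phi> w"
      using orbit_refl[of z] zw(3) by simp
    then obtain h where h: "h \<in> carrier G" "z = \<phi> h w"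
      by (auto simp: orbit_def)
    obtain g where g: "g \<in> carrier G" "dist w (\<phi> g y) < r y"
      using zw(2) by (auto simp: V_def)
    have "dist z (\<phi> (h \<otimes> g) y) < r y"
      using g h by (simp add: act_mult)
    then show ?thesis
      using g h zw(1) by (auto simp: V_def)
  qed
  have "openin ?Q (orbit G \<phi> ` V y)" for y
  proof -
    have V_sub: "V y \<subseteq> Y" by (auto simp: V_def)
    have "{z \<in> Y. orbit G \<phi> z \<in> orbit G \<phi> ` V y} = V y"
    proof (intro equalityI subsetI)
      fix z assume "z \<in> {z \<in> Y. orbit G \<phi> z \<in> orbit G \<phi> ` V y}"
      then show "z \<in> V y" using sat by blast
    next
      fix z assume "z \<in> V y"
      then show "z \<in> {z \<in> Y. orbit G \<phi> z \<in> orbit G \<phi> ` V y}" using V_sub by blast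
    qed
    moreover have "V y = Y \<inter> (\<Union>g\<in>carrier G. ball (\<phi> g y) (r y))"
      unfolding V_def by (simp add: set_eq_iff dist_commute)
    then have "openin (top_of_set Y) (V y)"
      by (simp add: openin_open_Int open_UN)
    ultimately show ?thesis
      using V_sub by (simp add: openin_quotient_topology image_mono)
  qed
  moreover have "topspace ?Q \<subseteq> (\<Union>y\<in>Y. orbit G \<phi> ` V y)"
  proof -
    have "y \<in> V y" if "y \<in> Y" for y
      using that pos by (auto simp: V_def intro!: bexI[of _ "\<one>"])
    moreover have "topspace ?Q \<subseteq> orbit G \<phi> ` Y"
      using openin_quotient_topology[of "top_of_set Y" "orbit G \<phi>" "topspace ?Q"] by simp
    ultimately show ?thesis by blast
  qed
  ultimately obtain \<F> where \<F>: "finite \<F>" "\<F> \<subseteq> (\<lambda>y. orbit G \<phi> ` V y) ` Y" "topspace ?Q \<subseteq> \<Union>\<F>"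
    using comp unfolding compact_space_alt
    by (elim allE[of _ "(\<lambda>y. orbit G \<phi> ` V y) ` Y"]) auto
  then obtain I where I: "I \<subseteq> Y" "finite I" "\<F> = (\<lambda>y. orbit G \<phi> ` V y) ` I"
    by (meson finite_subset_image)
  have "\<exists>y\<in>I. \<exists>g\<in>carrier G. dist z (\<phi> g y) < r y" if z: "z \<in> Y" for z
  proof -
    have "orbit G \<phi> z \<in> topspace ?Q"
      using quotient_imp_surjective_map[OF quotient_map_quotient_topology[of "top_of_set Y" "orbit G \<phi>"]] z
      by auto
    then obtain y w where "y \<in> I" "w \<in> V y" "orbit G \<phi> z = orbit G \<phi> w"
      using \<F>(3) I(3) by blast
    then have "z \<in> V y" using sat z by blast
    then show ?thesis using \<open>y \<in> I\<close> by (auto simp: V_def)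
  qed
  then show ?thesis using that I by blast
qed

end

lemma hull_geodesically_convex:
  assumes "geodesic_segment c x y"
    and "x \<in> hull_of_boundary_set B" "y \<in> hull_of_boundary_set B" "t \<in> {0..dist x y}"
  shows "c t \<in> hull_of_boundary_set B"
proof -
  have "c t \<in> C" if "closed C" "convex_with_boundary C B" for C
  proof -
    have "x \<in> C" "y \<in> C"
      using assms(2,3) that by (auto simp: hull_of_boundary_set_def)
    then show ?thesis
      using that(2) assms(1,4) unfolding convex_with_boundary_def by (meson image_subset_iff)
  qed
  then show ?thesis
    by (auto simp: hull_of_boundary_set_def)
qed

locale free_group_action = free_group G A + isometric_group_action G \<phi>
  for G :: "('g, 'b) monoid_scheme" (structure) and A
    and \<phi> :: "'g \<Rightarrow> 'x::cat_minus_one \<Rightarrow> 'x"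
begin

text \<open>Walking along a geodesic of \<open>Y\<close> in steps of length \<open>\<eta>\<close> and recording which translated ball
  contains the current point writes \<open>inv g \<otimes> g'\<close> as a product of transitions, one for each step.
  The radii are quarters so that two radii and one step add up to less than
  \<open>(\<epsilon> y + \<epsilon> y') / 2\<close>.\<close>
lemma chain_word_length:
  assumes convex: "\<And>c z z' t. geodesic_segment c z z' \<Longrightarrow> z \<in> Y \<Longrightarrow> z' \<in> Y \<Longrightarrow> t \<in> {0..dist z z'} \<Longrightarrow> c t \<in> Y"
    and cover: "\<And>z. z \<in> Y \<Longrightarrow> \<exists>y\<in>I. \<exists>g\<in>carrier G. dist z (\<phi> g y) < \<epsilon> y / 4"
    and \<eta>: "0 < \<eta>" "\<And>y. y \<in> I \<Longrightarrow> \<eta> \<le> \<epsilon> y / 4"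
    and transition: "\<And>y y' h. y \<in> I \<Longrightarrow> y' \<in> I \<Longrightarrow> h \<in> carrier G \<Longrightarrow>
        dist (\<phi> h y') y < (\<epsilon> y + \<epsilon> y') / 2 \<Longrightarrow> len h \<le> M"
  shows "\<lbrakk>z \<in> Y; z' \<in> Y; dist z z' \<le> \<eta> * real (Suc N); y \<in> I; y' \<in> I; g \<in> carrier G; g' \<in> carrier G;
      dist z (\<phi> g y) < \<epsilon> y / 4; dist z' (\<phi> g' y') < \<epsilon> y' / 4\<rbrakk> \<Longrightarrow> len (inv g \<otimes> g') \<le> M * Suc N"
proof (induction N arbitrary: z' y' g')
  case 0
  have "dist (\<phi> (inv g \<otimes> g') y') y = dist (\<phi> g' y') (\<phi> g y)"
    using 0 by (simp add: act_mult dist_act_inv)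
  also have "\<dots> \<le> dist z' (\<phi> g' y') + dist z z' + dist z (\<phi> g y)"
    using dist_triangle[of "\<phi> g' y'" "\<phi> g y" z'] dist_triangle[of z' "\<phi> g y" z]
    by (simp add: dist_commute)
  also have "\<dots> < (\<epsilon> y + \<epsilon> y') / 2"
    using 0 \<eta>(1) \<eta>(2)[of y] \<eta>(2)[of y'] by simp
  finally show ?case
    using transition[of y y' "inv g \<otimes> g'"] 0 by simp
next
  case (Suc N)
  obtain c where c: "geodesic_segment c z z'"
    using geodesic_segment_exists by blast
  define t where "t = min (\<eta> * real (Suc N)) (dist z z')"
  have t: "t \<in> {0..dist z z'}" "t \<le> \<eta> * real (Suc N)" "dist z z' - t \<le> \<eta>"
    using \<eta>(1) Suc.prems(3) by (auto simp: t_def algebra_simps)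
  have ct: "c t \<in> Y"
    by (rule convex[OF c Suc.prems(1,2) t(1)])
  then obtain w h where w: "w \<in> I" "h \<in> carrier G" "dist (c t) (\<phi> h w) < \<epsilon> w / 4"
    using cover by blast
  have d: "dist z (c t) = t" "dist (c t) z' = dist z z' - t"
    using c t(1) unfolding geodesic_segment_def geodesic_on_def
    by (smt (verit, best) atLeastAtMost_iff)+
  have 1: "len (inv g \<otimes> h) \<le> M * Suc N"
    using Suc.IH[of "c t" w h] Suc.prems ct w d t(2) by simp
  have "dist (\<phi> (inv h \<otimes> g') y') w = dist (\<phi> g' y') (\<phi> h w)"
    using Suc.prems w by (simp add: act_mult dist_act_inv)
  also have "\<dots> \<le> dist z' (\<phi> g' y') + dist (c t) z' + dist (c t) (\<phi> h w)"
    using dist_triangle[of "\<phi> g' y'" "\<phi> h w" z'] dist_triangle[of z' "\<phi> h w" "c t"]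
    by (simp add: dist_commute)
  also have "\<dots> < (\<epsilon> w + \<epsilon> y') / 2"
    using Suc.prems w d t \<eta>(1) \<eta>(2)[of w] \<eta>(2)[of y'] by simp
  finally have 2: "len (inv h \<otimes> g') \<le> M"
    using transition[of w y' "inv h \<otimes> g'"] Suc.prems w by simp
  have "h \<otimes> (inv h \<otimes> g') = g'"
    using Suc.prems w by (simp add: m_assoc[symmetric])
  then have "inv g \<otimes> g' = (inv g \<otimes> h) \<otimes> (inv h \<otimes> g')"
    using Suc.prems w by (simp add: m_assoc)
  then show ?case
    using word_length_mult_le[of "inv g \<otimes> h" "inv h \<otimes> g'"] 1 2 Suc.prems w by simp
qed

text \<open>The hull is covered by translates of finitely many balls, chosen so small that only finitely
  many group elements occur as transitions between overlapping translates. A geodesic of the hull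
  from \<open>y0\<close> to \<open>\<phi> g y0\<close> therefore spells \<open>g\<close> with a number of letters proportional to its length.
  Working with small balls replaces properness of the hull, which is not immediate.\<close>
theorem Svarc_Milnor_lower_bound:
  assumes pd: "properly_discontinuous G \<phi>" and cc: "convex_cocompact G \<phi> x0"
  obtains \<alpha> \<beta> where "0 \<le> \<alpha>"
    "\<And>g. g \<in> carrier G \<Longrightarrow> real (len g) \<le> \<alpha> * dist x0 (\<phi> g x0) + \<beta>"
proof -
  define Y where "Y = hull_of_boundary_set (limit_set G \<phi> x0)"
  have "Y \<noteq> {}" and comp: "compact_space (quotient_topology (top_of_set Y) (orbit G \<phi>))"
    using cc by (auto simp: convex_cocompact_def Y_def Let_def)
  then obtain y0 where y0: "y0 \<in> Y" by blast
  have "\<exists>\<epsilon>>0. finite {g \<in> carrier G. dist (\<phi> g y) y < 2 * \<epsilon>}" for y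
  proof -
    obtain \<epsilon> where "\<epsilon> > 0" "finite {g \<in> carrier G. dist (\<phi> g y) y < \<epsilon>}"
      using orbit_locally_finite[OF pd] by blast
    then show ?thesis by (intro exI[of _ "\<epsilon> / 2"]) simp
  qed
  then obtain \<epsilon> where \<epsilon>: "\<And>y. \<epsilon> y > 0" "\<And>y. finite {g \<in> carrier G. dist (\<phi> g y) y < 2 * \<epsilon> y}"
    by metis
  obtain I where I: "finite I" "I \<subseteq> Y"
    and cover: "\<And>z. z \<in> Y \<Longrightarrow> \<exists>y\<in>I. \<exists>g\<in>carrier G. dist z (\<phi> g y) < \<epsilon> y / 4"
    using quotient_compact_finite_cover[OF comp, of "\<lambda>y. \<epsilon> y / 4"] \<epsilon>(1) by auto
  obtain y g0 where y: "y \<in> I" "g0 \<in> carrier G" "dist y0 (\<phi> g0 y) < \<epsilon> y / 4"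
    using cover[OF y0] by blast
  define \<eta> where "\<eta> = Min ((\<lambda>y. \<epsilon> y / 4) ` I)"
  have \<eta>: "0 < \<eta>" "\<And>y. y \<in> I \<Longrightarrow> \<eta> \<le> \<epsilon> y / 4"
  proof -
    have "\<eta> \<in> (\<lambda>y. \<epsilon> y / 4) ` I"
      unfolding \<eta>_def using I(1) y(1) by (intro Min_in) auto
    then show "0 < \<eta>" using \<epsilon>(1) by auto
    show "\<eta> \<le> \<epsilon> y / 4" if "y \<in> I" for y
      unfolding \<eta>_def using I(1) that by (intro Min_le) auto
  qed
  define T where "T = (\<Union>y\<in>I. \<Union>y'\<in>I. {h \<in> carrier G. dist (\<phi> h y') y < (\<epsilon> y + \<epsilon> y') / 2})"
  have "finite T"
    unfolding T_def using I(1) transitions_finite[OF \<epsilon>(2) \<epsilon>(2)] by blast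
  define M where "M = Max (insert 0 (len ` T))"
  have M: "len h \<le> M" if "h \<in> T" for h
    unfolding M_def using that \<open>finite T\<close> by (intro Max_ge) auto
  have bound: "real (len g) \<le> real M / \<eta> * dist x0 (\<phi> g x0) +
      (real M * (2 * dist x0 y0 / \<eta> + 1) + real (len g0 + len (inv g0)))" if g: "g \<in> carrier G" for g
  proof -
    define D where "D = dist y0 (\<phi> g y0)"
    define N where "N = nat \<lfloor>D / \<eta>\<rfloor>"
    have "0 \<le> D / \<eta>" using \<eta>(1) by (simp add: D_def)
    then have N: "real N \<le> D / \<eta>" "D / \<eta> \<le> real (Suc N)"
      unfolding N_def by linarith+
    \<comment> \<open>\<open>y0\<close> need not be a centre of the cover: the chain runs from \<open>\<phi> g0 y\<close> to \<open>\<phi> (g \<otimes> g0) y\<close>,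
      which changes \<open>g\<close> by conjugation with the fixed element \<open>g0\<close>.\<close>
    have "len (inv g0 \<otimes> (g \<otimes> g0)) \<le> M * Suc N"
    proof (rule chain_word_length[where Y = Y and I = I and \<epsilon> = \<epsilon> and \<eta> = \<eta> and z = y0 and z' = "\<phi> g y0" and y = y and y' = y])
      show "\<phi> g y0 \<in> Y"
        using hull_invariant[OF g] y0 by (simp add: Y_def)
      show "dist y0 (\<phi> g y0) \<le> \<eta> * real (Suc N)"
        using N(2) \<eta>(1) by (simp add: D_def field_simps)
      show "len h \<le> M" if "y \<in> I" "y' \<in> I" "h \<in> carrier G" "dist (\<phi> h y') y < (\<epsilon> y + \<epsilon> y') / 2" for y y' h
        using that by (intro M) (auto simp: T_def)
      show "c t \<in> Y" if "geodesic_segment c z z'" "z \<in> Y" "z' \<in> Y" "t \<in> {0..dist z z'}" for c z z' t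
        using hull_geodesically_convex[OF that(1)] that(2-4) by (simp add: Y_def)
      show "dist (\<phi> g y0) (\<phi> (g \<otimes> g0) y) < \<epsilon> y / 4"
        using g y by (simp add: act_mult)
    qed (use y y0 g \<eta> cover in auto)
    moreover have "len g \<le> len g0 + len (inv g0 \<otimes> (g \<otimes> g0)) + len (inv g0)"
    proof -
      have "g = g0 \<otimes> (inv g0 \<otimes> (g \<otimes> g0)) \<otimes> inv g0"
      proof -
        have "g0 \<otimes> (inv g0 \<otimes> (g \<otimes> g0)) = g \<otimes> g0"
          using g y by (simp add: m_assoc[symmetric])
        then show ?thesis using g y by (simp add: m_assoc)
      qed
      then show ?thesis
        using word_length_mult_le[of g0 "inv g0 \<otimes> (g \<otimes> g0)"]
          word_length_mult_le[of "g0 \<otimes> (inv g0 \<otimes> (g \<otimes> g0))" "inv g0"] g y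
        by simp
    qed
    ultimately have "len g \<le> M * Suc N + (len g0 + len (inv g0))"
      by linarith
    then have "real (len g) \<le> real (M * Suc N + (len g0 + len (inv g0)))"
      by (rule of_nat_mono)
    then have "real (len g) \<le> real M * real (Suc N) + real (len g0 + len (inv g0))"
      by (simp only: of_nat_add of_nat_mult)
    moreover have "D \<le> dist x0 (\<phi> g x0) + 2 * dist x0 y0"
      using dist_triangle[of y0 "\<phi> g y0" x0] dist_triangle[of x0 "\<phi> g y0" "\<phi> g x0"] g
      by (simp add: D_def dist_commute)
    then have "D / \<eta> \<le> (dist x0 (\<phi> g x0) + 2 * dist x0 y0) / \<eta>"
      using \<eta>(1) by (simp add: divide_right_mono)
    then have "real (Suc N) \<le> dist x0 (\<phi> g x0) / \<eta> + (2 * dist x0 y0 / \<eta> + 1)"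
      using N(1) by (simp add: add_divide_distrib)
    then have "real M * real (Suc N) \<le> real M * (dist x0 (\<phi> g x0) / \<eta> + (2 * dist x0 y0 / \<eta> + 1))"
      by (rule mult_left_mono) simp
    ultimately show ?thesis
      by (simp add: algebra_simps)
  qed
  show ?thesis
    using that[OF _ bound] \<eta>(1) by simp
qed

end


section \<open>Displacement along reduced words\<close>

locale based_free_group_action = free_group_action G A \<phi>
  for G :: "('g, 'b) monoid_scheme" (structure) and A
    and \<phi> :: "'g \<Rightarrow> 'x::cat_minus_one \<Rightarrow> 'x" +
  fixes x0 :: 'x
begin

definition displ :: "('g \<times> bool) list \<Rightarrow> real" where
  "displ w = dist x0 (\<phi> (val w) x0)"

text \<open>Inserting \<open>0\<close> makes the maximum well defined and non-negative also when there are no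
  generators.\<close>
definition max_step :: real where
  "max_step = Max (insert 0 ((\<lambda>l. displ [l]) ` (A \<times> UNIV)))"

lemma max_step_nonneg [simp]: "0 \<le> max_step"
  and displ_letter_le: "l \<in> A \<times> UNIV \<Longrightarrow> displ [l] \<le> max_step"
  using finite_generators by (auto simp: max_step_def intro!: Max_ge)

lemma displ_Nil [simp]: "displ [] = 0"
  by (simp add: displ_def)

lemma dist_prefix:
  assumes "v \<in> words A" "w \<in> words A"
  shows "dist (\<phi> (val v) x0) (\<phi> (val (v @ w)) x0) = displ w"
  using assms by (simp add: word_value_append act_mult displ_def)

lemma displ_append:
  assumes "v \<in> words A" "w \<in> words A"
  shows "displ (v @ w) \<le> displ v + displ w" "displ w \<le> displ v + displ (v @ w)"
  using dist_prefix[OF assms] dist_triangle[of x0 "\<phi> (val (v @ w)) x0" "\<phi> (val v) x0"]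
    dist_triangle[of "\<phi> (val v) x0" "\<phi> (val (v @ w)) x0" x0]
  by (simp_all add: displ_def dist_commute)

lemma displ_Cons:
  assumes "l \<in> A \<times> UNIV" "w \<in> words A"
  shows "\<bar>displ (l # w) - displ w\<bar> \<le> max_step"
  using displ_append[of "[l]" w] displ_letter_le[of l] assms by simp

lemma displ_le_length: "w \<in> words A \<Longrightarrow> displ w \<le> max_step * real (length w)"
proof (induction w)
  case (Cons l w)
  then show ?case using displ_Cons[of l w] by (simp add: algebra_simps)
qed simp

lemma displ_inverse_word: "w \<in> words A \<Longrightarrow> displ (inverse_word w) = displ w"
  using dist_act_inv[of "val w" x0 x0] by (simp add: word_value_inverse_word displ_def dist_commute)

text \<open>The prefixes of a reduced word trace a path in the orbit whose steps are bounded and whose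
  points separate linearly, since subwords of a reduced word are reduced. Its point after \<open>v\<close> is
  therefore logarithmically close to the geodesic between the endpoints, and the displacements of
  the two parts almost add up.\<close>
lemma displ_reduced_append:
  assumes lower: "\<And>g. g \<in> carrier G \<Longrightarrow> real (len g) \<le> \<alpha> * dist x0 (\<phi> g x0) + \<beta>" and "0 \<le> \<alpha>"
    and w: "v \<in> words A" "w \<in> words A" "reduced (v @ w)" and N: "length (v @ w) \<le> 2 ^ N"
  defines "r \<equiv> max_step + 2 * real N"
  shows "displ v + displ w \<le> displ (v @ w) + 2 * (r + max_step * (2 * \<alpha> * r + \<beta>))"
proof -
  define y where "y = (\<lambda>i. \<phi> (val (take i (v @ w))) x0)"
  have y: "dist (y i) (y j) = displ (take (j - i) (drop i (v @ w)))" if "i \<le> j" for i j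
  proof -
    have "take j (v @ w) = take i (v @ w) @ take (j - i) (drop i (v @ w))"
      using that take_add[of i "j - i" "v @ w"] by simp
    moreover have "take i (v @ w) \<in> words A" "take (j - i) (drop i (v @ w)) \<in> words A"
      using w(1,2) by (intro words_take_drop; simp)+
    ultimately show ?thesis
      unfolding y_def using dist_prefix by metis
  qed
  have sub: "take a (drop b (v @ w)) \<in> words A" "reduced (take a (drop b (v @ w)))" for a b
    using w by (intro words_take_drop reduced_take_drop; simp)+
  have "dist (y 0) (y (length v)) + dist (y (length v)) (y (length (v @ w)))
      \<le> dist (y 0) (y (length (v @ w))) + 2 * (r + max_step * (2 * \<alpha> * r + \<beta>))"
    unfolding r_def
  proof (rule quasi_geodesic_near_geodesic)
    show "dist (y i) (y (Suc i)) \<le> max_step" if "i < length (v @ w)" for i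
    proof -
      have "dist (y i) (y (Suc i)) = displ (take (Suc i - i) (drop i (v @ w)))"
        by (rule y) simp
      also have "\<dots> \<le> max_step * real (length (take (Suc i - i) (drop i (v @ w))))"
        by (rule displ_le_length[OF sub(1)])
      also have "length (take (Suc i - i) (drop i (v @ w))) = 1"
        using that by simp
      finally show ?thesis by simp
    qed
    show "real (l - i) \<le> \<alpha> * dist (y i) (y l) + \<beta>" if "i \<le> l" "l \<le> length (v @ w)" for i l
    proof -
      have "len (val (take (l - i) (drop i (v @ w)))) = l - i"
        using word_length_reduced[OF sub, of "l - i" i] that
        by (simp only: length_take length_drop)
      moreover have "real (len (val (take (l - i) (drop i (v @ w)))))
          \<le> \<alpha> * dist x0 (\<phi> (val (take (l - i) (drop i (v @ w)))) x0) + \<beta>"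
        by (intro lower word_value_closed sub)
      ultimately show ?thesis
        unfolding y[OF that(1)] displ_def by (simp only:)
    qed
  qed (use N \<open>0 \<le> \<alpha>\<close> in auto)
  then show ?thesis
    using y[of 0 "length v"] y[of "length v" "length (v @ w)"] y[of 0 "length (v @ w)"] by simp
qed

text \<open>Conjugation by \<open>v\<close> contributes the displacement of \<open>v\<close> twice, once for each outer part, while
  the inner word \<open>u\<close> is of bounded length.\<close>
lemma displ_conjugate:
  assumes lower: "\<And>g. g \<in> carrier G \<Longrightarrow> real (len g) \<le> \<alpha> * dist x0 (\<phi> g x0) + \<beta>" and "0 \<le> \<alpha>"
    and w: "u \<in> words A" "v \<in> words A" "reduced (inverse_word v @ u @ v)"
    and N: "length (inverse_word v @ u @ v) \<le> 2 ^ N"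
  defines "r \<equiv> max_step + 2 * real N"
  shows "\<bar>displ (inverse_word v @ u @ v) - 2 * displ v\<bar>
    \<le> max_step * real (length u) + 2 * \<bar>r + max_step * (2 * \<alpha> * r + \<beta>)\<bar>"
proof -
  have "displ v + displ (u @ v) \<le>
      displ (inverse_word v @ u @ v) + 2 * (r + max_step * (2 * \<alpha> * r + \<beta>))"
    using displ_reduced_append[OF lower \<open>0 \<le> \<alpha>\<close>, of "inverse_word v" "u @ v" N] w N
    by (simp add: displ_inverse_word r_def)
  moreover have "displ (inverse_word v @ u @ v) \<le> displ v + displ (u @ v)"
    using displ_append(1)[of "inverse_word v" "u @ v"] w by (simp add: displ_inverse_word)
  moreover have "displ u \<le> max_step * real (length u)"
    using displ_le_length w by blast
  ultimately show ?thesis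
    using displ_append[of u v] w by simp
qed

end


section \<open>Averages over spheres with a prescribed first letter\<close>

text \<open>Choose \<open>N\<close> such that from there on the perturbation is below \<open>(1 - \<theta>) \<epsilon> / 2\<close>. Then
  \<open>h - \<epsilon> / 2\<close> contracts by the factor \<open>\<theta>\<close> in every step.\<close>
lemma contraction_tendsto_zero:
  fixes h b :: "nat \<Rightarrow> real"
  assumes rec: "\<And>n. h (Suc n) \<le> \<theta> * h n + b n" and nonneg: "\<And>n. 0 \<le> h n"
    and \<theta>: "0 \<le> \<theta>" "\<theta> < 1" and b: "b \<longlonglongrightarrow> 0"
  shows "h \<longlonglongrightarrow> 0"
proof (rule LIMSEQ_I)
  fix \<epsilon> :: real assume "0 < \<epsilon>"
  then have "0 < (1 - \<theta>) * (\<epsilon> / 2)" using \<theta> by simp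
  then obtain N where N: "\<And>n. n \<ge> N \<Longrightarrow> \<bar>b n\<bar> < (1 - \<theta>) * (\<epsilon> / 2)"
    using LIMSEQ_D[OF b] by (metis diff_zero real_norm_def)
  have bound: "h (N + j) \<le> \<epsilon> / 2 + \<theta> ^ j * h N" for j
  proof (induction j)
    case (Suc j)
    have "h (N + Suc j) \<le> \<theta> * h (N + j) + (1 - \<theta>) * (\<epsilon> / 2)"
      using rec[of "N + j"] N[of "N + j"] by simp
    also have "\<dots> \<le> \<theta> * (\<epsilon> / 2 + \<theta> ^ j * h N) + (1 - \<theta>) * (\<epsilon> / 2)"
      using Suc \<theta> by (simp add: mult_left_mono)
    also have "\<dots> = \<epsilon> / 2 + \<theta> ^ Suc j * h N"
      by (simp add: field_simps)
    finally show ?case .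
  qed (use \<open>0 < \<epsilon>\<close> in simp)
  have "(\<lambda>j. \<theta> ^ j * h N) \<longlonglongrightarrow> 0"
    using LIMSEQ_power_zero[of \<theta>] \<theta> by (intro tendsto_mult_left_zero) simp
  then obtain J where J: "\<And>j. j \<ge> J \<Longrightarrow> \<bar>\<theta> ^ j * h N\<bar> < \<epsilon> / 2"
    using LIMSEQ_D[of _ 0 "\<epsilon> / 2"] \<open>0 < \<epsilon>\<close> by (metis diff_zero half_gt_zero real_norm_def)
  show "\<exists>n0. \<forall>n\<ge>n0. norm (h n - 0) < \<epsilon>"
  proof (intro exI allI impI)
    fix n assume "n \<ge> N + J"
    then obtain j where "n = N + j" "j \<ge> J"
      by (metis add.assoc le_Suc_ex le_add1)
    then show "norm (h n - 0) < \<epsilon>"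
      using bound[of j] J[of j] nonneg[of n] by simp
  qed
qed

context based_free_group_action
begin

text \<open>The denominator is the number of reduced words with first letter \<open>s\<close> and length \<open>n + 1\<close>.\<close>
definition mean_displ_from :: "'g \<times> bool \<Rightarrow> nat \<Rightarrow> real" where
  "mean_displ_from s n = (\<Sum>w\<in>reduced_words_from A s n. displ w) / real (2 * card A - 1) ^ n"

text \<open>Removing the first letter changes the displacement by a bounded amount, and the remaining word
  may start with every letter except \<open>flip s\<close>.\<close>
lemma mean_displ_from_Suc:
  assumes s: "s \<in> A \<times> UNIV" and "A \<noteq> {}"
  defines "q \<equiv> real (2 * card A - 1)"
  shows "\<bar>q * mean_displ_from s (Suc n) -
    ((\<Sum>t\<in>A \<times> UNIV. mean_displ_from t n) - mean_displ_from (flip s) n)\<bar> \<le> q * max_step"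
proof -
  let ?T = "A \<times> (UNIV::bool set) - {flip s}"
  have "card A \<ge> 1"
    using finite_generators \<open>A \<noteq> {}\<close> by (simp add: Suc_le_eq card_gt_0_iff)
  then have q: "q > 0" by (simp add: q_def)
  have finT: "finite (A \<times> (UNIV::bool set))" using finite_generators by simp
  have cardT: "real (card ?T) = q"
    using s finite_generators
    by (subst card_Diff_singleton) (auto simp: card_cartesian_product q_def mult.commute)
  have "\<bar>(\<Sum>w\<in>reduced_words_from A s (Suc n). displ w) - (\<Sum>t\<in>?T. \<Sum>w\<in>reduced_words_from A t n. displ w)\<bar>
      = \<bar>\<Sum>t\<in>?T. \<Sum>w\<in>reduced_words_from A t n. displ (s # w) - displ w\<bar>"
    by (simp add: sum_reduced_words_from_Suc[OF finite_generators s] sum_subtractf)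
  also have "\<dots> \<le> (\<Sum>t\<in>?T. \<Sum>w\<in>reduced_words_from A t n. max_step)"
  proof (intro order_trans[OF sum_abs] sum_mono)
    fix t w assume "w \<in> reduced_words_from A t n"
    then show "\<bar>displ (s # w) - displ w\<bar> \<le> max_step"
      using displ_Cons[OF s] by (simp add: reduced_words_from_def reduced_words_def)
  qed
  also have "\<dots> = q ^ Suc n * max_step"
    using card_reduced_words_from[OF finite_generators, of _ n] cardT by (simp add: q_def)
  finally have bound: "\<bar>(\<Sum>w\<in>reduced_words_from A s (Suc n). displ w) -
      (\<Sum>t\<in>?T. \<Sum>w\<in>reduced_words_from A t n. displ w)\<bar> \<le> q ^ Suc n * max_step" .
  have 1: "q * mean_displ_from s (Suc n) = (\<Sum>w\<in>reduced_words_from A s (Suc n). displ w) / q ^ n"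
    unfolding mean_displ_from_def q_def[symmetric] using q by simp
  have "(\<Sum>t\<in>A \<times> UNIV. mean_displ_from t n) - mean_displ_from (flip s) n = (\<Sum>t\<in>?T. mean_displ_from t n)"
    using finT s by (subst sum_diff1) auto
  also have "\<dots> = (\<Sum>t\<in>?T. \<Sum>w\<in>reduced_words_from A t n. displ w) / q ^ n"
    by (simp add: mean_displ_from_def q_def sum_divide_distrib)
  finally have "q * mean_displ_from s (Suc n) -
      ((\<Sum>t\<in>A \<times> UNIV. mean_displ_from t n) - mean_displ_from (flip s) n) =
      ((\<Sum>w\<in>reduced_words_from A s (Suc n). displ w) -
        (\<Sum>t\<in>?T. \<Sum>w\<in>reduced_words_from A t n. displ w)) / q ^ n"
    using 1 by (simp add: diff_divide_distrib)
  also have "\<bar>\<dots>\<bar> \<le> q ^ Suc n * max_step / q ^ n"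
    using divide_right_mono[OF bound, of "q ^ n"] q by (simp add: abs_divide power_abs)
  also have "\<dots> = q * max_step"
    using q by simp
  finally show ?thesis .
qed

lemma sphere_mean_eq:
  "1 / real (card (sphere_in G A (carrier G) (Suc n))) *
      (\<Sum>x\<in>sphere_in G A (carrier G) (Suc n). dist x0 (\<phi> x x0) / real (Suc n)) =
    (\<Sum>s\<in>A \<times> UNIV. mean_displ_from s n / real (Suc n)) / real (2 * card A)"
proof -
  let ?q = "2 * card A - 1"
  have "real (card (sphere_in G A (carrier G) (Suc n))) = real (card (reduced_words A (Suc n)))"
    by (simp add: sphere_in_carrier card_image[OF inj_on_reduced_words])
  also have "\<dots> = (\<Sum>w\<in>reduced_words A (Suc n). 1)"
    by simp
  also have "\<dots> = real (2 * card A) * real ?q ^ n"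
    unfolding sum_reduced_words_Suc[OF finite_generators]
    using card_reduced_words_from[OF finite_generators, of _ n]
    by (simp add: card_cartesian_product)
  finally have card: "real (card (sphere_in G A (carrier G) (Suc n))) = real (2 * card A) * real ?q ^ n" .
  have "(\<Sum>x\<in>sphere_in G A (carrier G) (Suc n). dist x0 (\<phi> x x0) / real (Suc n)) =
      (\<Sum>w\<in>reduced_words A (Suc n). displ w / real (Suc n))"
    unfolding sphere_in_carrier by (subst sum.reindex[OF inj_on_reduced_words]) (simp add: displ_def)
  also have "\<dots> = (\<Sum>s\<in>A \<times> UNIV. (\<Sum>w\<in>reduced_words_from A s n. displ w) / real (Suc n))"
    unfolding sum_reduced_words_Suc[OF finite_generators] by (simp add: sum_divide_distrib)
  finally show ?thesis
    unfolding card by (simp add: mean_displ_from_def sum_divide_distrib sum_distrib_left mult.commute mult.left_commute)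
qed

text \<open>The hypothesis controls only the average over all first letters. By \<open>mean_displ_from_Suc\<close> the
  mean with first letter \<open>s\<close> is, up to a bounded error, a multiple of this average on the previous
  sphere minus \<open>1 / q\<close> times the previous mean with first letter \<open>flip s\<close>. Let \<open>H n\<close> be the sum over
  all first letters of the deviations of the means, divided by the length, from \<open>lam\<close>. In each step
  it is contracted by the factor \<open>1 / q\<close>, up to a null sequence. Here \<open>\<sigma> n\<close> measures how far the
  controlled average still is from its limit.\<close>
theorem mean_displ_from_tendsto:
  assumes mean: "(\<lambda>n. 1 / real (card (sphere_in G A (carrier G) n)) *
      (\<Sum>x\<in>sphere_in G A (carrier G) n. dist x0 (\<phi> x x0) / real n)) \<longlonglongrightarrow> lam"
    and card: "card A \<ge> 2" and s: "s \<in> A \<times> UNIV"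
  shows "(\<lambda>n. mean_displ_from s n / real (Suc n)) \<longlonglongrightarrow> lam"
proof -
  define \<Lambda> where "\<Lambda> = A \<times> (UNIV :: bool set)"
  define q where "q = real (2 * card A - 1)"
  define p2 where "p2 = real (2 * card A)"
  have q: "q > 1" "p2 = q + 1" "A \<noteq> {}"
    using card by (auto simp: q_def p2_def)
  have fin: "finite \<Lambda>" and card\<Lambda>: "real (card \<Lambda>) = p2"
    using finite_generators by (auto simp: \<Lambda>_def p2_def card_cartesian_product)
  define y where "y = (\<lambda>n s. mean_displ_from s n / real (Suc n))"
  define \<sigma> where "\<sigma> = (\<lambda>n. (\<Sum>s\<in>\<Lambda>. y n s) - p2 * lam)"
  define H where "H = (\<lambda>n. \<Sum>s\<in>\<Lambda>. \<bar>y n s - lam\<bar>)"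
  define b where "b = (\<lambda>n. p2 * (\<bar>\<sigma> n\<bar> / q + (max_step + \<bar>lam\<bar>) / real (n + 2)))"
  have "(\<lambda>n. p2 * ((\<Sum>s\<in>\<Lambda>. y n s) / p2) - p2 * lam) \<longlonglongrightarrow> p2 * lam - p2 * lam"
    using LIMSEQ_Suc[OF mean] unfolding sphere_mean_eq
    by (intro tendsto_intros) (simp add: \<Lambda>_def y_def p2_def)
  then have \<sigma>: "\<sigma> \<longlonglongrightarrow> 0"
    using q by (simp add: \<sigma>_def)
  have "(\<lambda>n. (max_step + \<bar>lam\<bar>) / real (n + 2)) \<longlonglongrightarrow> 0"
    using LIMSEQ_ignore_initial_segment[OF lim_const_over_n[of "max_step + \<bar>lam\<bar>"], of 2] by simp
  then have "b \<longlonglongrightarrow> p2 * (\<bar>0\<bar> / q + 0)"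
    unfolding b_def using q by (intro tendsto_intros \<sigma>) auto
  then have b: "b \<longlonglongrightarrow> 0" by simp
  have single: "\<bar>y (Suc n) s - lam\<bar> \<le>
      \<bar>y n (flip s) - lam\<bar> / q + (\<bar>\<sigma> n\<bar> / q + (max_step + \<bar>lam\<bar>) / real (n + 2))"
    if s: "s \<in> \<Lambda>" for n s
  proof -
    define e where "e = q * mean_displ_from s (Suc n) -
      ((\<Sum>t\<in>\<Lambda>. mean_displ_from t n) - mean_displ_from (flip s) n)"
    have e: "\<bar>e\<bar> \<le> q * max_step"
      using mean_displ_from_Suc[OF _ q(3), of s n] s by (simp add: e_def \<Lambda>_def q_def)
    define h where "h = y n (flip s) - lam"
    define c where "c = real (Suc n) / real (n + 2)"
    have c: "0 \<le> c" "c \<le> 1" "c = 1 - 1 / real (n + 2)"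
      by (simp_all add: c_def field_simps)
    have mean_y: "mean_displ_from t n = real (Suc n) * y n t" for t
      by (simp add: y_def)
    have "q * mean_displ_from s (Suc n) = real (Suc n) * ((\<Sum>t\<in>\<Lambda>. y n t) - y n (flip s)) + e"
      by (simp add: e_def mean_y sum_distrib_left algebra_simps)
    also have "(\<Sum>t\<in>\<Lambda>. y n t) - y n (flip s) = q * lam + (\<sigma> n - h)"
      using q(2) by (simp add: \<sigma>_def h_def algebra_simps)
    finally have "mean_displ_from s (Suc n) = (real (Suc n) * (q * lam + (\<sigma> n - h)) + e) / q"
      using q(1) by (simp add: field_simps)
    then have "y (Suc n) s = (real (Suc n) * (q * lam + (\<sigma> n - h)) + e) / q / real (n + 2)"
      by (simp add: y_def)
    also have "\<dots> = c * (lam + (\<sigma> n - h) / q) + e / q / real (n + 2)"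
    proof -
      have expand: "(m * (q * lam + d) + e) / q / N = m / N * (lam + d / q) + e / q / N" if "N > 0" for m N d :: real
        using that q(1) by (simp add: add_divide_distrib distrib_left)
      show ?thesis
        unfolding c_def by (rule expand) simp
    qed
    finally have "y (Suc n) s - lam = c * (lam + (\<sigma> n - h) / q) + e / q / real (n + 2) - lam"
      by simp
    also have "\<dots> = c * ((\<sigma> n - h) / q) + e / q / real (n + 2) - lam / real (n + 2)"
    proof -
      have "c * lam = lam - lam / real (n + 2)"
        unfolding c(3) by (simp add: left_diff_distrib)
      then show ?thesis
        unfolding distrib_left by simp
    qed
    also have "\<bar>\<dots>\<bar> \<le> \<bar>c * ((\<sigma> n - h) / q)\<bar> + \<bar>e / q / real (n + 2)\<bar> + \<bar>lam / real (n + 2)\<bar>"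
    proof -
      have "\<bar>a + b - d\<bar> \<le> \<bar>a\<bar> + \<bar>b\<bar> + \<bar>d\<bar>" for a b d :: real
        by linarith
      then show ?thesis .
    qed
    also have "\<dots> \<le> (\<bar>h\<bar> / q + \<bar>\<sigma> n\<bar> / q) + max_step / real (n + 2) + \<bar>lam\<bar> / real (n + 2)"
    proof (intro add_mono)
      have "\<bar>c * ((\<sigma> n - h) / q)\<bar> \<le> 1 * \<bar>(\<sigma> n - h) / q\<bar>"
        unfolding abs_mult using c by (intro mult_right_mono) auto
      also have "\<dots> \<le> (\<bar>h\<bar> + \<bar>\<sigma> n\<bar>) / q"
        using q(1) by (auto intro!: divide_right_mono)
      finally show "\<bar>c * ((\<sigma> n - h) / q)\<bar> \<le> \<bar>h\<bar> / q + \<bar>\<sigma> n\<bar> / q"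
        by (simp add: add_divide_distrib)
      show "\<bar>e / q / real (n + 2)\<bar> \<le> max_step / real (n + 2)"
      proof -
        have "\<bar>e\<bar> / q \<le> max_step"
          using e q(1) by (simp add: pos_divide_le_eq mult.commute)
        then have "\<bar>e\<bar> / q / real (n + 2) \<le> max_step / real (n + 2)"
          by (rule divide_right_mono) simp
        then show ?thesis
          using q(1) by (simp add: abs_divide)
      qed
    qed simp
    finally show ?thesis
      by (simp add: h_def add_divide_distrib)
  qed
  have "H (Suc n) \<le> 1 / q * H n + b n" for n
  proof -
    have "H (Suc n) \<le> (\<Sum>s\<in>\<Lambda>. \<bar>y n (flip s) - lam\<bar> / q +
        (\<bar>\<sigma> n\<bar> / q + (max_step + \<bar>lam\<bar>) / real (n + 2)))"
      unfolding H_def using single by (intro sum_mono)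
    also have "\<dots> = (\<Sum>s\<in>\<Lambda>. \<bar>y n (flip s) - lam\<bar>) / q + b n"
      by (simp add: sum.distrib b_def card\<Lambda> sum_divide_distrib)
    also have "(\<Sum>s\<in>\<Lambda>. \<bar>y n (flip s) - lam\<bar>) = H n"
      unfolding H_def
      by (rule sum.reindex_bij_witness[of _ flip flip]) (auto simp: \<Lambda>_def flip_def)
    finally show ?thesis by simp
  qed
  then have H: "H \<longlonglongrightarrow> 0"
    by (rule contraction_tendsto_zero) (use q b in \<open>auto simp: H_def sum_nonneg\<close>)
  have "\<bar>y n s - lam\<bar> \<le> H n" for n
    unfolding H_def using fin s by (intro member_le_sum[of s \<Lambda>]) (auto simp: \<Lambda>_def)
  then have "(\<lambda>n. y n s - lam) \<longlonglongrightarrow> 0"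
    by (intro Lim_null_comparison[OF _ H] always_eventually) simp
  then show ?thesis
    by (simp add: LIM_zero_iff y_def)
qed

end


section \<open>Conjugacy classes in reduced words\<close>

definition cyclically_reduced :: "('g \<times> bool) list \<Rightarrow> bool" where
  "cyclically_reduced w \<longleftrightarrow> w \<noteq> [] \<and> reduced w \<and> hd w \<noteq> flip (last w)"

text \<open>Rotating a word does not change which pairs of letters are cyclically adjacent.\<close>
lemma cyclically_reduced_rotate:
  "cyclically_reduced (l # w) \<longleftrightarrow> cyclically_reduced (w @ [l])"
proof (cases w rule: rev_cases)
  case (snoc v m)
  show ?thesis
    unfolding snoc
    by (cases v) (auto simp: cyclically_reduced_def reduced_append reduced_Cons hd_append)
qed simp

lemma reduced_conjugate_iff:
  assumes "cyclically_reduced u" "v \<noteq> []"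
  shows "reduced (inverse_word v @ u @ v) \<longleftrightarrow> reduced v \<and> hd v \<noteq> hd u \<and> hd v \<noteq> flip (last u)"
  using assms by (auto simp: cyclically_reduced_def reduced_append last_inverse_word)

lemma (in group) conjugacy_class_subset: "C \<in> conjugacy_classes G \<Longrightarrow> C \<subseteq> carrier G"
  by (auto simp: conjugacy_classes_def)

lemma (in group) conjugacy_class_conj:
  assumes C: "C \<in> conjugacy_classes G" and x: "x \<in> C" and g: "g \<in> carrier G"
  shows "g \<otimes> x \<otimes> inv g \<in> C"
proof -
  obtain y h where y: "y \<in> carrier G" "C = {g \<otimes> y \<otimes> inv g | g. g \<in> carrier G}"
    and h: "h \<in> carrier G" "x = h \<otimes> y \<otimes> inv h"
    using C x by (auto simp: conjugacy_classes_def)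
  have "g \<otimes> x \<otimes> inv g = (g \<otimes> h) \<otimes> y \<otimes> inv (g \<otimes> h)"
    using y h g by (simp add: m_assoc inv_mult_group)
  then show ?thesis
    using y h g by blast
qed

text \<open>The inverse stands on the left because words are conjugated as
  \<open>inverse_word v @ u @ v\<close>.\<close>
lemma (in group) conjugacy_class_transitive:
  assumes C: "C \<in> conjugacy_classes G" and x: "x \<in> C" and x': "x' \<in> C"
  obtains g where "g \<in> carrier G" "x' = inv g \<otimes> x \<otimes> g"
proof -
  obtain y h h' where y: "y \<in> carrier G"
    and h: "h \<in> carrier G" "x = h \<otimes> y \<otimes> inv h" and h': "h' \<in> carrier G" "x' = h' \<otimes> y \<otimes> inv h'"
    using C x x' by (auto simp: conjugacy_classes_def)
  have "inv h \<otimes> (h \<otimes> (y \<otimes> inv h')) = y \<otimes> inv h'" "inv h \<otimes> (h \<otimes> inv h') = inv h'"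
    using y h(1) h'(1) by (simp_all add: m_assoc[symmetric])
  then have "x' = inv (h \<otimes> inv h') \<otimes> x \<otimes> (h \<otimes> inv h')"
    using y h h' by (simp add: m_assoc inv_mult_group)
  then show ?thesis
    using that[of "h \<otimes> inv h'"] h h' by simp
qed

context free_group
begin

lemma val_Cons: "l \<in> A \<times> UNIV \<Longrightarrow> w \<in> words A \<Longrightarrow> val (l # w) = val [l] \<otimes> val w"
  using word_value_append[of "[l]" w] by simp

text \<open>Stated with \<open>flip l\<close> first; the opposite order is the case \<open>l := flip l\<close>.\<close>
lemma val_cancel:
  assumes "v \<in> words A" "w \<in> words A" "l \<in> A \<times> UNIV"
  shows "val (v @ flip l # l # w) = val (v @ w)"
proof -
  have l: "val [l] \<in> carrier G" using assms(3) by (intro word_value_closed) simp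
  have "val (flip l # l # w) = inv (val [l]) \<otimes> (val [l] \<otimes> val w)"
    using assms val_Cons[of "flip l" "l # w"] val_Cons[of l w] word_value_flip[of l]
    by (simp del: word_value.simps)
  also have "\<dots> = val w"
    using l assms(2) by (simp add: m_assoc[symmetric] del: word_value.simps)
  finally show ?thesis
    using assms by (simp add: word_value_append del: word_value.simps)
qed

text \<open>The cyclically reduced representatives of length \<open>k\<close>. Keeping all of them, instead of one
  representative and its rotations, makes closure under rotation immediate.\<close>
definition cores :: "'a set \<Rightarrow> nat \<Rightarrow> ('a \<times> bool) list set" where
  "cores C k = {u \<in> words A. cyclically_reduced u \<and> length u = k \<and> val u \<in> C}"

lemma finite_cores: "finite (cores C k)"
  by (rule finite_subset[OF _ finite_reduced_words[OF finite_generators, of k]])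
    (auto simp: cores_def reduced_words_def cyclically_reduced_def)

lemma val_rotate_in_class:
  assumes C: "C \<in> conjugacy_classes G" and w: "l \<in> A \<times> UNIV" "w \<in> words A"
  shows "val (l # w) \<in> C \<longleftrightarrow> val (w @ [l]) \<in> C"
proof -
  have l: "val [l] \<in> carrier G" using w by (intro word_value_closed) simp
  have 1: "val (l # w) = val [l] \<otimes> val w" "val (w @ [l]) = val w \<otimes> val [l]"
    using w val_Cons[of l w] word_value_append[of w "[l]"] by simp_all
  have "inv (val [l]) \<otimes> (val [l] \<otimes> val w) \<otimes> inv (inv (val [l])) = val w \<otimes> val [l]"
    using l w by (simp add: m_assoc[symmetric] del: word_value.simps)
  moreover have "val [l] \<otimes> (val w \<otimes> val [l]) \<otimes> inv (val [l]) = val [l] \<otimes> val w"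
    using l w by (simp add: m_assoc del: word_value.simps)
  ultimately show ?thesis
    unfolding 1 using conjugacy_class_conj[OF C] l inv_closed[OF l] by metis
qed

lemma cores_rotate:
  assumes "C \<in> conjugacy_classes G"
  shows "l # w \<in> cores C k \<longleftrightarrow> w @ [l] \<in> cores C k"
  using val_rotate_in_class[OF assms, of l w] cyclically_reduced_rotate[of l w]
  by (auto simp: cores_def simp del: word_value.simps)

text \<open>A cancellation between \<open>v\<close> and the core moves one letter of the core from one end to the other
  and shortens \<open>v\<close>. After finitely many rotations nothing cancels any more.\<close>
lemma conjugate_core_reduced:
  assumes C: "C \<in> conjugacy_classes G"
  shows "u \<in> cores C k \<Longrightarrow> v \<in> words A \<Longrightarrow> reduced v \<Longrightarrow>
    \<exists>u'\<in>cores C k. \<exists>v'\<in>words A. reduced (inverse_word v' @ u' @ v') \<and>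
      val (inverse_word v' @ u' @ v') = val (inverse_word v @ u @ v)"
proof (induction v arbitrary: u)
  case Nil
  then show ?case
    by (intro bexI[of _ u] bexI[of _ "[]"]) (auto simp: cores_def cyclically_reduced_def)
next
  case (Cons l w)
  have u: "u \<in> words A" "cyclically_reduced u" "u \<noteq> []"
    using Cons.prems(1) by (auto simp: cores_def cyclically_reduced_def)
  have lw: "l \<in> A \<times> UNIV" "w \<in> words A" "reduced w"
    using Cons.prems(2,3) by (auto simp: reduced_Cons)
  consider "hd u = l" | "last u = flip l" | "l \<noteq> hd u" "l \<noteq> flip (last u)"
    by (metis flip_flip)
  then show ?case
  proof cases
    case 1
    then obtain t where t: "u = l # t" using u(3) by (cases u) auto
    have "t @ [l] \<in> cores C k"
      using Cons.prems(1) cores_rotate[OF C] unfolding t by blast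
    moreover have "val (inverse_word (l # w) @ u @ (l # w)) = val (inverse_word w @ (t @ [l]) @ w)"
      using val_cancel[of "inverse_word w" "t @ l # w" l] u lw by (simp add: t del: word_value.simps)
    ultimately show ?thesis
      using Cons.IH lw by metis
  next
    case 2
    then obtain t where t: "u = t @ [flip l]" using u(3) by (cases u rule: rev_cases) auto
    have "flip l # t \<in> cores C k"
      using Cons.prems(1) cores_rotate[OF C] unfolding t by blast
    moreover have "val (inverse_word (l # w) @ u @ (l # w)) = val (inverse_word w @ (flip l # t) @ w)"
      using val_cancel[of "inverse_word w @ flip l # t" "w" l] u lw
      by (simp add: t del: word_value.simps)
    ultimately show ?thesis
      using Cons.IH lw by metis
  next
    case 3
    then have "reduced (inverse_word (l # w) @ u @ (l # w))"
      using reduced_conjugate_iff[OF u(2), of "l # w"] Cons.prems(3) by simp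
    then show ?thesis
      using Cons.prems by metis
  qed
qed

lemma val_conjugate:
  "u \<in> words A \<Longrightarrow> v \<in> words A \<Longrightarrow> val (inverse_word v @ u @ v) = inv (val v) \<otimes> val u \<otimes> val v"
  by (simp add: word_value_append word_value_inverse_word m_assoc)

text \<open>A shortest element of the class has a cyclically reduced word: otherwise a rotation would
  bring two inverse letters together and yield a shorter conjugate.\<close>
lemma cores_nonempty:
  assumes C: "C \<in> conjugacy_classes G" and nontrivial: "C \<noteq> {\<one>}"
    and k: "k = (LEAST n. \<exists>x\<in>C. len x = n)"
  shows "cores C k \<noteq> {}"
proof -
  obtain x' where "x' \<in> C"
    using C one_closed by (auto simp: conjugacy_classes_def)
  then have "\<exists>x\<in>C. len x = len x'" by blast
  then have "\<exists>x\<in>C. len x = k"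
    unfolding k by (rule LeastI[where P = "\<lambda>n. \<exists>x\<in>C. len x = n"])
  then obtain x where x: "x \<in> C" "len x = k" by blast
  then obtain w where w: "w \<in> words A" "reduced w" "val w = x" "length w = k"
    using reduced_word_exists conjugacy_class_subset[OF C] by blast
  have minimal: "k \<le> len y" if "y \<in> C" for y
    unfolding k by (rule Least_le) (use that in blast)
  have "w \<noteq> []"
  proof
    assume "w = []"
    then have "\<one> \<in> C" using x w by simp
    have "y = \<one>" if "y \<in> C" for y
      using conjugacy_class_transitive[OF C \<open>\<one> \<in> C\<close> that] by (metis l_inv r_one inv_closed)
    then show False using nontrivial \<open>\<one> \<in> C\<close> by blast
  qed
  moreover have "hd w \<noteq> flip (last w)"
  proof
    assume h: "hd w = flip (last w)"
    obtain l v where lv: "w = l # v" using \<open>w \<noteq> []\<close> by (cases w) auto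
    have "v \<noteq> []" using h lv by auto
    then obtain t m where "v = t @ [m]" by (cases v rule: rev_cases) auto
    then have t: "w = flip m # t @ [m]" using h lv by simp
    have tm: "t \<in> words A" "m \<in> A \<times> UNIV" using w(1) t by auto
    have "val (t @ [m] @ [flip m]) \<in> C"
      using val_rotate_in_class[OF C, of "flip m" "t @ [m]"] tm x(1) w(3) t
      by (simp del: word_value.simps)
    then have "val t \<in> C"
      using val_cancel[of t "[]" "flip m"] tm by (simp del: word_value.simps)
    then have "k \<le> length t"
      using minimal word_length_le[OF tm(1)] by (meson le_trans)
    then show False using w(4) t by simp
  qed
  ultimately have "w \<in> cores C k"
    using w x by (auto simp: cores_def cyclically_reduced_def)
  then show ?thesis by blast
qed

text \<open>The pairs of a core \<open>u\<close> and a first letter of \<open>v\<close> for which \<open>inverse_word v @ u @ v\<close> is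
  reduced at its two joints.\<close>
definition admissible :: "'a set \<Rightarrow> nat \<Rightarrow> (('a \<times> bool) list \<times> ('a \<times> bool)) set" where
  "admissible C k = (SIGMA u:cores C k. {s \<in> A \<times> UNIV. s \<noteq> hd u \<and> s \<noteq> flip (last u)})"

lemma finite_admissible: "finite (admissible C k)"
  using finite_cores finite_generators by (auto simp: admissible_def)

lemma admissible_nonempty:
  assumes "cores C k \<noteq> {}" "card A \<ge> 2"
  shows "admissible C k \<noteq> {}"
proof -
  obtain u where u: "u \<in> cores C k" using assms(1) by blast
  have "card {hd u, flip (last u)} < card (A \<times> (UNIV :: bool set))"
    using assms(2) card_insert_le_m1[of 2 "{flip (last u)}" "hd u"]
    by (simp add: card_cartesian_product)
  then have "\<not> A \<times> UNIV \<subseteq> {hd u, flip (last u)}"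
    by (meson card_mono finite.emptyI finite.insertI leD)
  then show ?thesis using u by (auto simp: admissible_def)
qed

definition conjugate_words :: "'a set \<Rightarrow> nat \<Rightarrow> nat \<Rightarrow> (('a \<times> bool) list \<times> ('a \<times> bool) list) set" where
  "conjugate_words C k m =
    (\<Union>(u, s)\<in>admissible C k. {u} \<times> reduced_words_from A s m)"

lemma conjugate_words_reduced:
  assumes "(u, v) \<in> conjugate_words C k m"
  shows "u \<in> cores C k" "u \<in> words A" "v \<in> words A" "length u = k" "length v = Suc m"
    "reduced (inverse_word v @ u @ v)"
proof -
  obtain s where s: "u \<in> cores C k" "s \<noteq> hd u" "s \<noteq> flip (last u)" "v \<in> reduced_words_from A s m"
    using assms by (auto simp: conjugate_words_def admissible_def)
  then show "u \<in> cores C k" "u \<in> words A" "v \<in> words A" "length u = k" "length v = Suc m"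
    by (auto simp: cores_def reduced_words_from_def reduced_words_def)
  then have "v \<noteq> []" by auto
  then show "reduced (inverse_word v @ u @ v)"
    using reduced_conjugate_iff[of u v] s
    by (auto simp: cores_def reduced_words_from_def reduced_words_def)
qed

lemma inj_on_conjugate_words:
  "inj_on (\<lambda>(u, v). val (inverse_word v @ u @ v)) (conjugate_words C k m)"
proof (rule inj_onI, clarify)
  fix u v u' v' assume uv: "(u, v) \<in> conjugate_words C k m" and uv': "(u', v') \<in> conjugate_words C k m"
    and eq: "val (inverse_word v @ u @ v) = val (inverse_word v' @ u' @ v')"
  note c = conjugate_words_reduced[OF uv] and c' = conjugate_words_reduced[OF uv']
  have "inverse_word v @ u @ v = inverse_word v' @ u' @ v'"
    by (rule inj_onD[OF reduced_words_inj eq]) (use c c' in auto)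
  then show "u = u' \<and> v = v'"
    using c c' by simp
qed

text \<open>Every element of the class is uniquely a reduced word \<open>inverse_word v @ u @ v\<close> with a core \<open>u\<close>;
  uniqueness holds because the length of \<open>u\<close> is fixed. On the sphere of radius \<open>k + 2 * Suc m\<close>
  the word \<open>v\<close> has length \<open>Suc m\<close>.\<close>
lemma sphere_in_conjugacy_class:
  assumes C: "C \<in> conjugacy_classes G" and cores: "cores C k \<noteq> {}"
  shows "sphere_in G A C (k + 2 * Suc m) =
    (\<lambda>(u, v). val (inverse_word v @ u @ v)) ` conjugate_words C k m"
proof (intro equalityI subsetI)
  fix x assume "x \<in> sphere_in G A C (k + 2 * Suc m)"
  then have x: "x \<in> C" "len x = k + 2 * Suc m" by (auto simp: sphere_in_def)
  obtain u0 where u0: "u0 \<in> cores C k" using cores by blast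
  then have u0': "val u0 \<in> C" "u0 \<in> words A" by (auto simp: cores_def)
  obtain g where g: "g \<in> carrier G" "x = inv g \<otimes> val u0 \<otimes> g"
    using conjugacy_class_transitive[OF C u0'(1) x(1)] by blast
  obtain v0 where v0: "v0 \<in> words A" "reduced v0" "val v0 = g"
    using reduced_word_exists[OF g(1)] by blast
  have "x = val (inverse_word v0 @ u0 @ v0)"
    using g v0 u0' by (simp add: val_conjugate)
  then obtain u v where uv: "u \<in> cores C k" "v \<in> words A" "reduced (inverse_word v @ u @ v)"
    "val (inverse_word v @ u @ v) = x"
    using conjugate_core_reduced[OF C u0 v0(1,2)] by metis
  have u: "u \<in> words A" "length u = k" "cyclically_reduced u"
    using uv(1) by (auto simp: cores_def)
  have "length (inverse_word v @ u @ v) = k + 2 * Suc m"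
    using word_length_reduced[OF _ uv(3)] uv u x(2) by simp
  then have len_v: "length v = Suc m" using u by simp
  then have "v \<noteq> []" by auto
  then have "reduced v" "hd v \<noteq> hd u" "hd v \<noteq> flip (last u)"
    using reduced_conjugate_iff[OF u(3)] uv(3) by auto
  moreover have "hd v \<in> A \<times> UNIV" using \<open>v \<noteq> []\<close> uv(2) by (cases v) auto
  ultimately have "(u, v) \<in> conjugate_words C k m"
    using uv len_v
    by (auto simp: conjugate_words_def admissible_def reduced_words_from_def reduced_words_def
        intro!: bexI[of _ "(u, hd v)"])
  then show "x \<in> (\<lambda>(u, v). val (inverse_word v @ u @ v)) ` conjugate_words C k m"
    using uv(4) by force
next
  fix x assume "x \<in> (\<lambda>(u, v). val (inverse_word v @ u @ v)) ` conjugate_words C k m"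
  then obtain u v where uv: "(u, v) \<in> conjugate_words C k m" "x = val (inverse_word v @ u @ v)"
    by auto
  note c = conjugate_words_reduced[OF uv(1)]
  have "inv (val v) \<otimes> val u \<otimes> inv (inv (val v)) \<in> C"
    using c by (intro conjugacy_class_conj[OF C]) (auto simp: cores_def)
  then have "x \<in> C"
    using uv(2) c by (simp add: val_conjugate)
  moreover have "len x = k + 2 * Suc m"
    using word_length_reduced[OF _ c(6)] uv(2) c by simp
  ultimately show "x \<in> sphere_in G A C (k + 2 * Suc m)"
    by (simp add: sphere_in_def)
qed

lemma sum_conjugate_words:
  "(\<Sum>uv\<in>conjugate_words C k m. f uv) =
    (\<Sum>(u, s)\<in>admissible C k. \<Sum>v\<in>reduced_words_from A s m. f (u, v))"
proof -
  have "(\<Sum>uv\<in>conjugate_words C k m. f uv) =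
      (\<Sum>us\<in>admissible C k. \<Sum>uv\<in>{fst us} \<times> reduced_words_from A (snd us) m. f uv)"
    unfolding conjugate_words_def case_prod_unfold
    by (intro sum.UNION_disjoint finite_admissible ballI impI)
      (auto simp: finite_reduced_words_from finite_generators, auto simp: reduced_words_from_def)
  also have "\<dots> = (\<Sum>us\<in>admissible C k. \<Sum>v\<in>reduced_words_from A (snd us) m. f (fst us, v))"
  proof -
    have "sum f ({a} \<times> B) = (\<Sum>v\<in>B. f (a, v))" for a B
    proof -
      have "{a} \<times> B = Pair a ` B" by auto
      then show ?thesis by (simp add: sum.reindex inj_on_def)
    qed
    then show ?thesis by simp
  qed
  finally show ?thesis by (simp add: case_prod_unfold)
qed

end


section \<open>Means over conjugacy classes\<close>

lemma le_power_ceiling_log: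
  assumes "n > 0"
  shows "n \<le> 2 ^ nat \<lceil>log 2 (real n)\<rceil>"
proof -
  have "real n = 2 powr log 2 (real n)"
    using assms by simp
  also have "\<dots> \<le> 2 powr real (nat \<lceil>log 2 (real n)\<rceil>)"
    by (intro powr_mono) (auto simp: le_nat_iff real_nat_ceiling_ge)
  also have "\<dots> = real (2 ^ nat \<lceil>log 2 (real n)\<rceil>)"
    by (simp add: powr_realpow)
  finally show ?thesis
    by (simp only: of_nat_le_iff)
qed

lemma ceiling_log_over_n: "(\<lambda>n. real (nat \<lceil>log 2 (real n)\<rceil>) / real n) \<longlonglongrightarrow> 0"
proof (rule Lim_null_comparison)
  show "\<forall>\<^sub>F n in sequentially. norm (real (nat \<lceil>log 2 (real n)\<rceil>) / real n)
      \<le> log 2 (real n) / real n + 1 / real n"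
  proof (rule eventually_sequentiallyI)
    fix n :: nat assume "1 \<le> n"
    then have "0 \<le> log 2 (real n)" by simp
    then have "real (nat \<lceil>log 2 (real n)\<rceil>) \<le> log 2 (real n) + 1" by linarith
    then have "real (nat \<lceil>log 2 (real n)\<rceil>) / real n \<le> (log 2 (real n) + 1) / real n"
      by (rule divide_right_mono) simp
    then show "norm (real (nat \<lceil>log 2 (real n)\<rceil>) / real n) \<le> log 2 (real n) / real n + 1 / real n"
      by (simp add: add_divide_distrib)
  qed
  show "(\<lambda>n. log 2 (real n) / real n + 1 / real n) \<longlonglongrightarrow> 0"
    by (rule tendsto_eq_intros lim_log_over_n lim_const_over_n)+ simp
qed

context based_free_group_action
begin

text \<open>The error of \<open>displ_conjugate\<close> for a core of length \<open>k\<close> and a reduced word of length \<open>n\<close>, with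
  the least \<open>N\<close> such that \<open>n \<le> 2 ^ N\<close>.\<close>
definition log_error :: "real \<Rightarrow> real \<Rightarrow> nat \<Rightarrow> nat \<Rightarrow> real" where
  "log_error \<alpha> \<beta> k n =
    (let r = max_step + 2 * real (nat \<lceil>log 2 (real n)\<rceil>)
     in max_step * real k + 2 * \<bar>r + max_step * (2 * \<alpha> * r + \<beta>)\<bar>)"

lemma log_error_over_n: "(\<lambda>n. log_error \<alpha> \<beta> k n / real n) \<longlonglongrightarrow> 0"
proof -
  define \<rho> where "\<rho> = (\<lambda>n. (max_step + 2 * real (nat \<lceil>log 2 (real n)\<rceil>)) / real n)"
  have "(\<lambda>n. max_step / real n + 2 * (real (nat \<lceil>log 2 (real n)\<rceil>) / real n)) \<longlonglongrightarrow> 0 + 2 * 0"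
    by (intro tendsto_intros ceiling_log_over_n lim_const_over_n)
  then have \<rho>: "\<rho> \<longlonglongrightarrow> 0"
    by (simp add: \<rho>_def add_divide_distrib)
  have "(\<lambda>n. max_step * real k / real n + 2 * \<bar>\<rho> n + max_step * (2 * \<alpha> * \<rho> n + \<beta> / real n)\<bar>)
      \<longlonglongrightarrow> 0 + 2 * \<bar>0 + max_step * (2 * \<alpha> * 0 + 0)\<bar>"
    by (intro tendsto_intros \<rho> lim_const_over_n)
  moreover have "log_error \<alpha> \<beta> k n / real n =
      max_step * real k / real n + 2 * \<bar>\<rho> n + max_step * (2 * \<alpha> * \<rho> n + \<beta> / real n)\<bar>" for n
  proof -
    have "\<bar>x\<bar> / real n = \<bar>x / real n\<bar>" for x by simp
    then show ?thesis
      by (simp add: log_error_def Let_def \<rho>_def add_divide_distrib times_divide_eq_right[symmetric]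
          del: times_divide_eq_right abs_divide)
  qed
  ultimately show ?thesis by simp
qed

lemma displ_conjugate_words:
  assumes lower: "\<And>g. g \<in> carrier G \<Longrightarrow> real (len g) \<le> \<alpha> * dist x0 (\<phi> g x0) + \<beta>" and "0 \<le> \<alpha>"
    and uv: "(u, v) \<in> conjugate_words C k m"
  shows "\<bar>displ (inverse_word v @ u @ v) - 2 * displ v\<bar> \<le> log_error \<alpha> \<beta> k (k + 2 * Suc m)"
proof -
  note c = conjugate_words_reduced[OF uv]
  have "length (inverse_word v @ u @ v) = k + 2 * Suc m"
    using c by simp
  then have "length (inverse_word v @ u @ v) \<le> 2 ^ nat \<lceil>log 2 (real (k + 2 * Suc m))\<rceil>"
    using le_power_ceiling_log[of "k + 2 * Suc m"] by simp
  from displ_conjugate[OF lower \<open>0 \<le> \<alpha>\<close> c(2,3,6) this] show ?thesis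
    using c(4) by (simp add: log_error_def Let_def)
qed

text \<open>All admissible pairs have the same number of words \<open>v\<close>, so the mean over the sphere of the
  class is, up to the logarithmic error, the plain mean of \<open>2 * mean_displ_from s m\<close> over the
  admissible pairs.\<close>
lemma class_sphere_mean:
  assumes C: "C \<in> conjugacy_classes G" and cores: "cores C k \<noteq> {}" and card: "card A \<ge> 2"
    and lower: "\<And>g. g \<in> carrier G \<Longrightarrow> real (len g) \<le> \<alpha> * dist x0 (\<phi> g x0) + \<beta>" and "0 \<le> \<alpha>"
  defines "n \<equiv> \<lambda>m. k + 2 * Suc m"
  shows "\<bar>1 / real (card (sphere_in G A C (n m))) * (\<Sum>x\<in>sphere_in G A C (n m). dist x0 (\<phi> x x0) / real (n m)) -
      (\<Sum>(u, s)\<in>admissible C k. 2 * mean_displ_from s m / real (n m)) / real (card (admissible C k))\<bar>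
    \<le> log_error \<alpha> \<beta> k (n m) / real (n m)"
proof -
  let ?P = "admissible C k" and ?W = "conjugate_words C k m"
  define q where "q = real (2 * card A - 1)"
  have q: "q > 0" using card by (simp add: q_def)
  have finP: "finite ?P" and P0: "card ?P > 0"
    using finite_admissible admissible_nonempty[OF cores card] by (auto simp: card_gt_0_iff)
  have letters: "s \<in> A \<times> UNIV" if "(u, s) \<in> ?P" for u s
    using that by (auto simp: admissible_def)
  have "real (card ?W) = (\<Sum>uv\<in>?W. 1)" by simp
  also have "\<dots> = (\<Sum>(u, s)\<in>?P. q ^ m)"
    unfolding sum_conjugate_words
    by (intro sum.cong refl) (auto simp: card_reduced_words_from[OF finite_generators letters] q_def)
  also have "\<dots> = real (card ?P) * q ^ m" by (simp add: case_prod_unfold)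
  finally have cardW: "real (card ?W) = real (card ?P) * q ^ m" .
  then have W0: "real (card ?W) > 0" using P0 q by simp
  have "(\<Sum>uv\<in>?W. 2 * displ (snd uv)) = (\<Sum>(u, s)\<in>?P. 2 * (\<Sum>v\<in>reduced_words_from A s m. displ v))"
    unfolding sum_conjugate_words by (simp add: sum_distrib_left)
  also have "\<dots> = q ^ m * (\<Sum>(u, s)\<in>?P. 2 * mean_displ_from s m)"
  proof -
    have "2 * (\<Sum>v\<in>reduced_words_from A s m. displ v) = q ^ m * (2 * mean_displ_from s m)" for s
      unfolding mean_displ_from_def q_def[symmetric] using q by simp
    then show ?thesis by (simp only: sum_distrib_left case_prod_unfold)
  qed
  finally have main: "(\<Sum>uv\<in>?W. 2 * displ (snd uv)) / real (card ?W) =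
      (\<Sum>(u, s)\<in>?P. 2 * mean_displ_from s m) / real (card ?P)"
    using q by (simp add: cardW)
  define f where "f = (\<lambda>(u, v). displ (inverse_word v @ u @ v))"
  have sphere: "1 / real (card (sphere_in G A C (n m))) *
      (\<Sum>x\<in>sphere_in G A C (n m). dist x0 (\<phi> x x0) / real (n m)) =
      (\<Sum>uv\<in>?W. f uv) / real (card ?W) / real (n m)"
    unfolding n_def sphere_in_conjugacy_class[OF C cores] card_image[OF inj_on_conjugate_words]
    by (subst sum.reindex[OF inj_on_conjugate_words])
      (simp add: f_def displ_def case_prod_unfold sum_divide_distrib[symmetric])
  have "\<bar>(\<Sum>uv\<in>?W. f uv) - (\<Sum>uv\<in>?W. 2 * displ (snd uv))\<bar> \<le> (\<Sum>uv\<in>?W. log_error \<alpha> \<beta> k (n m))"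
    unfolding sum_subtractf[symmetric]
    using displ_conjugate_words[OF lower \<open>0 \<le> \<alpha>\<close>]
    by (intro order_trans[OF sum_abs] sum_mono) (auto simp: f_def n_def)
  also have "\<dots> = real (card ?W) * log_error \<alpha> \<beta> k (n m)" by simp
  finally have "\<bar>(\<Sum>uv\<in>?W. f uv) - (\<Sum>uv\<in>?W. 2 * displ (snd uv))\<bar> / real (card ?W) \<le> log_error \<alpha> \<beta> k (n m)"
    using W0 by (simp add: pos_divide_le_eq mult.commute)
  then have "\<bar>(\<Sum>uv\<in>?W. f uv) / real (card ?W) - (\<Sum>uv\<in>?W. 2 * displ (snd uv)) / real (card ?W)\<bar>
      \<le> log_error \<alpha> \<beta> k (n m)"
    by (simp add: diff_divide_distrib[symmetric])
  then have "\<bar>(\<Sum>uv\<in>?W. f uv) / real (card ?W) -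
      (\<Sum>(u, s)\<in>?P. 2 * mean_displ_from s m) / real (card ?P)\<bar> / real (n m) \<le> log_error \<alpha> \<beta> k (n m) / real (n m)"
    unfolding main by (rule divide_right_mono) simp
  moreover have "(\<Sum>(u, s)\<in>?P. 2 * mean_displ_from s m / real (n m)) / real (card ?P) =
      (\<Sum>(u, s)\<in>?P. 2 * mean_displ_from s m) / real (card ?P) / real (n m)"
    by (simp add: sum_divide_distrib case_prod_unfold mult.commute)
  moreover have "\<bar>x - y\<bar> / real (n m) = \<bar>x / real (n m) - y / real (n m)\<bar>" for x y
    by (simp add: diff_divide_distrib[symmetric])
  ultimately show ?thesis
    unfolding sphere by simp
qed

text \<open>The number of admissible pairs does not depend on the radius, so the limit passes through the
  finite mean. The factor 2 is absorbed since \<open>v\<close> makes up half of the word asymptotically.\<close>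
theorem class_sphere_mean_tendsto:
  assumes mean: "(\<lambda>n. 1 / real (card (sphere_in G A (carrier G) n)) *
      (\<Sum>x\<in>sphere_in G A (carrier G) n. dist x0 (\<phi> x x0) / real n)) \<longlonglongrightarrow> lam"
    and card: "card A \<ge> 2"
    and C: "C \<in> conjugacy_classes G" and cores: "cores C k \<noteq> {}"
    and lower: "\<And>g. g \<in> carrier G \<Longrightarrow> real (len g) \<le> \<alpha> * dist x0 (\<phi> g x0) + \<beta>" and "0 \<le> \<alpha>"
  shows "(\<lambda>m. 1 / real (card (sphere_in G A C (k + 2 * m))) *
      (\<Sum>x\<in>sphere_in G A C (k + 2 * m). dist x0 (\<phi> x x0) / real (k + 2 * m))) \<longlonglongrightarrow> lam"
    (is "?M \<longlonglongrightarrow> lam")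
proof -
  let ?P = "admissible C k"
  define n where "n = (\<lambda>m. k + 2 * Suc m)"
  define L where "L = (\<lambda>m. (\<Sum>(u, s)\<in>?P. 2 * mean_displ_from s m / real (n m)) / real (card ?P))"
  have sub: "strict_mono n" by (auto simp: strict_mono_def n_def)
  have "(\<lambda>m. 1 - real k / real (n m)) \<longlonglongrightarrow> 1 - 0"
    using LIMSEQ_subseq_LIMSEQ[OF lim_const_over_n[of "real k"] sub]
    by (intro tendsto_intros) (simp add: o_def)
  moreover have "1 - real k / real (n m) = 2 * real (Suc m) / real (n m)" for m
    by (simp add: n_def field_simps)
  ultimately have ratio: "(\<lambda>m. 2 * real (Suc m) / real (n m)) \<longlonglongrightarrow> 1" by simp
  have "(\<lambda>m. 2 * mean_displ_from s m / real (n m)) \<longlonglongrightarrow> lam" if "s \<in> A \<times> UNIV" for s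
  proof -
    have "(\<lambda>m. mean_displ_from s m / real (Suc m) * (2 * real (Suc m) / real (n m))) \<longlonglongrightarrow> lam * 1"
      by (intro tendsto_mult ratio mean_displ_from_tendsto[OF mean card that])
    moreover have "mean_displ_from s m / real (Suc m) * (2 * real (Suc m) / real (n m)) =
        2 * mean_displ_from s m / real (n m)" for m
      by (simp del: of_nat_Suc)
    ultimately show ?thesis by simp
  qed
  then have "L \<longlonglongrightarrow> (\<Sum>(u, s)\<in>?P. lam) / real (card ?P)"
    unfolding L_def case_prod_unfold using admissible_nonempty[OF cores card] finite_admissible
    by (intro tendsto_intros) (auto simp: admissible_def)
  moreover have "(\<Sum>(u, s)\<in>?P. lam) / real (card ?P) = lam"
    using admissible_nonempty[OF cores card] finite_admissible by (simp add: case_prod_unfold)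
  ultimately have L: "L \<longlonglongrightarrow> lam" by simp
  have bound: "norm (?M (Suc m) - L m) \<le> log_error \<alpha> \<beta> k (n m) / real (n m)" for m
    unfolding L_def n_def real_norm_def
    by (rule class_sphere_mean[OF C cores card lower \<open>0 \<le> \<alpha>\<close>])
  have "(\<lambda>m. log_error \<alpha> \<beta> k (n m) / real (n m)) \<longlonglongrightarrow> 0"
    using LIMSEQ_subseq_LIMSEQ[OF log_error_over_n sub] by (simp add: o_def)
  then have "(\<lambda>m. ?M (Suc m) - L m) \<longlonglongrightarrow> 0"
    by (rule Lim_null_comparison[OF always_eventually[OF allI[OF bound]]])
  from tendsto_add[OF this L] have "(\<lambda>m. ?M (Suc m)) \<longlonglongrightarrow> lam"
    by simp
  then show ?thesis
    by (rule LIMSEQ_imp_Suc)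
qed

end

theorem theorem1p1:
  fixes \<Gamma> :: "('g, 'b) monoid_scheme"
    and \<A> :: "'g set"
    and p :: nat
    and \<phi> :: "'g \<Rightarrow> 'x::cat_minus_one \<Rightarrow> 'x"
    and x0 :: 'x
    and lam :: real
    and \<C> :: "'g set"
    and k :: nat
  assumes "group \<Gamma>"
    and "p \<ge> 2" and "card \<A> = p" and "free_generating_set \<Gamma> \<A>"
    and "isometric_action \<Gamma> \<phi>" and "properly_discontinuous \<Gamma> \<phi>" and "convex_cocompact \<Gamma> \<phi> x0"
    and "lam > 0"
    and "(\<lambda>n. 1 / real (card (sphere_in \<Gamma> \<A> (carrier \<Gamma>) n)) *
            (\<Sum>x\<in>sphere_in \<Gamma> \<A> (carrier \<Gamma>) n. dist x0 (\<phi> x x0) / real n)) \<longlonglongrightarrow> lam"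
    and "\<C> \<in> conjugacy_classes \<Gamma>" and "\<C> \<noteq> {\<one>\<^bsub>\<Gamma>\<^esub>}"
    and "k = (LEAST n. \<exists>x\<in>\<C>. word_length \<Gamma> \<A> x = n)"
  shows "(\<lambda>m. 1 / real (card (sphere_in \<Gamma> \<A> \<C> (k + 2 * m))) *
            (\<Sum>x\<in>sphere_in \<Gamma> \<A> \<C> (k + 2 * m). dist x0 (\<phi> x x0) / real (k + 2 * m)))
          \<longlonglongrightarrow> lam"
proof -
  have "finite \<A>"
    using assms(2,3) by (intro card_ge_0_finite) simp
  then interpret based_free_group_action \<Gamma> \<A> \<phi> x0
    using assms(1,4,5)
    by (simp add: based_free_group_action_def free_group_action_def free_group_def
        free_group_axioms_def isometric_group_action_def isometric_group_action_axioms_def)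
  obtain \<alpha> \<beta> where "0 \<le> \<alpha>"
    "\<And>g. g \<in> carrier \<Gamma> \<Longrightarrow> real (word_length \<Gamma> \<A> g) \<le> \<alpha> * dist x0 (\<phi> g x0) + \<beta>"
    using Svarc_Milnor_lower_bound[OF assms(6,7)] by blast
  then show ?thesis
    using class_sphere_mean_tendsto[OF assms(9) _ assms(10) cores_nonempty[OF assms(10,11,12)]] assms(2,3)
    by blast
qed

end
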